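(* Let $(H,\langle\,,\rangle)$ be a polarized integral Hodge structure of weight $2$ with $\dim H^{2,0}=1$, let $C(H)$ be its Clifford algebra, and put on $C(H)\cong\bigwedge H$ the weight $2$ Hodge structure in which, for every $k$, inside $\bigwedge^kH_{\mathbb{C}}$, the subspace $H^{2,0}\wedge\bigwedge^{k-1}H^{1,1}$ has type $(2,0)$, the subspace $H^{0,2}\wedge\bigwedge^{k-1}H^{1,1}$ has type $(0,2)$, and the subspaces $\bigwedge^kH^{1,1}$ and $H^{2,0}\wedge H^{0,2}\wedge\bigwedge^{k-2}H^{1,1}$ have type $(1,1)$. Then this Hodge structure is compatible with the product on $C(H)$: the Clifford multiplication $C(H)\otimes C(H)\to C(H)$ is a morphism of Hodge structures of bidegree $(-1,-1)$.
   Context: A polarized integral Hodge structure of weight $2$ is a lattice $H$ with a decomposition $H_{\mathbb{C}}:=H\otimes\mathbb{C}=H^{2,0}\oplus H^{1,1}\oplus H^{0,2}$, $\overline{H^{2,0}}=H^{0,2}$, $\overline{H^{1,1}}=H^{1,1}$, and an integral symmetric bilinear form $\langle\,,\rangle$ such that the decomposition is orthogonal for $h(\alpha,\beta)=\langle\alpha,\overline{\beta}\rangle$, with $h$ positive definite on $H^{2,0}$ and $H^{0,2}$ and negative definite on $H^{1,1}$. The Clifford algebra $C(H)$ is the quotient of the tensor algebra of $H$ by the two-sided ideal generated by the relations $h\otimes h=-\langle h,h\rangle 1$, $h\in H$. As a lattice it is canonically identified with the exterior algebra $\bigwedge H$; under this identification $1\mapsto 1$ and left Clifford multiplication by $h\in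 H$ is $h\wedge\,\cdot\;-\;h\lrcorner\,\cdot$, where $h\lrcorner$ is contraction with the element $\langle h,\cdot\rangle$ of $H^*$. Bidegree $(-1,-1)$ means: the product of elements of types $(p,q)$ and $(r,s)$ lies in the part of type $(p+r-1,q+s-1)$, which is $0$ unless that is one of $(2,0),(1,1),(0,2)$. *)

theory Defs
  imports Complex_Main "HOL-Library.Poly_Mapping" "HOL-Algebra.QuotRing" "HOL-Algebra.Module"
begin

section \<open>Linear algebra over the ring of all elements of a type\<close>

definition scalar_ring :: "'r::comm_ring_1 ring" where
  "scalar_ring = \<lparr>carrier = UNIV, mult = (*), one = 1, zero = 0, add = (+)\<rparr>"

text \<open>A type with a scalar multiplication, as a module record. The fields \<open>mult\<close> and \<open>one\<close>
  of the record are irrelevant for modules.\<close>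

definition module_of :: "('r \<Rightarrow> 'm \<Rightarrow> 'm) \<Rightarrow> ('r, 'm::ab_group_add) module" where
  "module_of s = \<lparr>carrier = UNIV, mult = (\<lambda>_ _. 0), one = 0, zero = 0, add = (+), smult = s\<rparr>"

definition span_of :: "('r::comm_ring_1, 'm) module \<Rightarrow> 'm set \<Rightarrow> 'm set" where
  "span_of M A = \<Inter>{N. submodule N scalar_ring M \<and> A \<subseteq> N}"

definition finite_basis :: "('r::comm_ring_1, 'm) module \<Rightarrow> 'm set \<Rightarrow> bool" where
  "finite_basis M B \<longleftrightarrow> finite B \<and> B \<subseteq> carrier M \<and>
     (\<forall>x\<in>carrier M. \<exists>!c. c \<in> B \<rightarrow>\<^sub>E UNIV \<and> x = (\<Oplus>\<^bsub>M\<^esub>b\<in>B. c b \<odot>\<^bsub>M\<^esub> b))"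

definition bilinear_map ::
  "('r::comm_ring_1, 'a) module \<Rightarrow> ('r, 'b) module \<Rightarrow> ('r, 'c) module \<Rightarrow> ('a \<Rightarrow> 'b \<Rightarrow> 'c) \<Rightarrow> bool" where
  "bilinear_map M N P f \<longleftrightarrow>
     (\<forall>x\<in>carrier M. \<forall>y\<in>carrier N. f x y \<in> carrier P) \<and>
     (\<forall>x\<in>carrier M. \<forall>x'\<in>carrier M. \<forall>y\<in>carrier N. f (x \<oplus>\<^bsub>M\<^esub> x') y = f x y \<oplus>\<^bsub>P\<^esub> f x' y) \<and>
     (\<forall>x\<in>carrier M. \<forall>y\<in>carrier N. \<forall>y'\<in>carrier N. f x (y \<oplus>\<^bsub>N\<^esub> y') = f x y \<oplus>\<^bsub>P\<^esub> f x y') \<and>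
     (\<forall>c. \<forall>x\<in>carrier M. \<forall>y\<in>carrier N. f (c \<odot>\<^bsub>M\<^esub> x) y = c \<odot>\<^bsub>P\<^esub> f x y) \<and>
     (\<forall>c. \<forall>x\<in>carrier M. \<forall>y\<in>carrier N. f x (c \<odot>\<^bsub>N\<^esub> y) = c \<odot>\<^bsub>P\<^esub> f x y)"


section \<open>Hodge structures of weight two\<close>

text \<open>\<open>L\<close> is a lattice (a free abelian group of finite rank), and \<open>\<iota> : L \<rightarrow> V\<close> exhibits the
  complex vector space \<open>V\<close> as \<open>L \<otimes> \<complex>\<close>: a \<open>\<int>\<close>-basis of \<open>L\<close> is mapped bijectively onto a
  \<open>\<complex>\<close>-basis of \<open>V\<close>.\<close>

definition complexified_lattice ::
  "(int, 'l) module \<Rightarrow> (complex, 'v) module \<Rightarrow> ('l \<Rightarrow> 'v) \<Rightarrow> bool" where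
  "complexified_lattice L V \<iota> \<longleftrightarrow>
     module scalar_ring L \<and> module scalar_ring V \<and>
     \<iota> \<in> carrier L \<rightarrow> carrier V \<and>
     (\<forall>x\<in>carrier L. \<forall>y\<in>carrier L. \<iota> (x \<oplus>\<^bsub>L\<^esub> y) = \<iota> x \<oplus>\<^bsub>V\<^esub> \<iota> y) \<and>
     (\<exists>B. finite_basis L B \<and> inj_on \<iota> B \<and> finite_basis V (\<iota> ` B))"

text \<open>\<open>cj\<close> is complex conjugation on \<open>L \<otimes> \<complex>\<close>, i.e. the antilinear map fixing \<open>L\<close>, and
  \<open>F p q\<close> is the part of type \<open>(p, q)\<close>.\<close>

locale hodge_structure2 =
  fixes L :: "(int, 'l) module" and V :: "(complex, 'v) module"
    and \<iota> :: "'l \<Rightarrow> 'v" and cj :: "'v \<Rightarrow> 'v" and F :: "int \<Rightarrow> int \<Rightarrow> 'v set"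
  assumes lattice: "complexified_lattice L V \<iota>"
    and cj_closed: "cj \<in> carrier V \<rightarrow> carrier V"
    and cj_add: "\<And>x y. x \<in> carrier V \<Longrightarrow> y \<in> carrier V \<Longrightarrow> cj (x \<oplus>\<^bsub>V\<^esub> y) = cj x \<oplus>\<^bsub>V\<^esub> cj y"
    and cj_smult: "\<And>c x. x \<in> carrier V \<Longrightarrow> cj (c \<odot>\<^bsub>V\<^esub> x) = cnj c \<odot>\<^bsub>V\<^esub> cj x"
    and cj_lattice: "\<And>x. x \<in> carrier L \<Longrightarrow> cj (\<iota> x) = \<iota> x"
    and subspace: "\<And>p q. submodule (F p q) scalar_ring V"
    and types: "\<And>p q. (p, q) \<notin> {(2, 0), (1, 1), (0, 2)} \<Longrightarrow> F p q = {\<zero>\<^bsub>V\<^esub>}"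
    and decomposition: "\<And>x. x \<in> carrier V \<Longrightarrow>
       \<exists>!(a, b, c). a \<in> F 2 0 \<and> b \<in> F 1 1 \<and> c \<in> F 0 2 \<and> x = a \<oplus>\<^bsub>V\<^esub> b \<oplus>\<^bsub>V\<^esub> c"
    and cj_types: "\<And>p q. cj ` F p q = F q p"

text \<open>\<open>Q\<close> is the integral form and \<open>QC\<close> its \<open>\<complex>\<close>-bilinear extension; the hermitian form \<open>h\<close> is
  \<open>\<lambda>a b. QC a (cj b)\<close>.\<close>

locale polarized_hodge_structure2 = hodge_structure2 L V \<iota> cj F
  for L :: "(int, 'l) module" and V :: "(complex, 'v) module" and \<iota> cj F +
  fixes Q :: "'l \<Rightarrow> 'l \<Rightarrow> int" and QC :: "'v \<Rightarrow> 'v \<Rightarrow> complex"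
  assumes form_bilinear: "bilinear_map L L (module_of (*)) Q"
    and form_symmetric: "\<And>x y. x \<in> carrier L \<Longrightarrow> y \<in> carrier L \<Longrightarrow> Q x y = Q y x"
    and formC_bilinear: "bilinear_map V V (module_of (*)) QC"
    and formC_extends: "\<And>x y. x \<in> carrier L \<Longrightarrow> y \<in> carrier L \<Longrightarrow> QC (\<iota> x) (\<iota> y) = of_int (Q x y)"
    and orthogonal: "\<And>p q r s a b. (p, q) \<noteq> (r, s) \<Longrightarrow> a \<in> F p q \<Longrightarrow> b \<in> F r s \<Longrightarrow> QC a (cj b) = 0"
    and positive: "\<And>p q a. (p, q) \<in> {(2, 0), (0, 2)} \<Longrightarrow> a \<in> F p q \<Longrightarrow> a \<noteq> \<zero>\<^bsub>V\<^esub> \<Longrightarrow>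
       QC a (cj a) \<in> \<real> \<and> Re (QC a (cj a)) > 0"
    and negative: "\<And>a. a \<in> F 1 1 \<Longrightarrow> a \<noteq> \<zero>\<^bsub>V\<^esub> \<Longrightarrow>
       QC a (cj a) \<in> \<real> \<and> Re (QC a (cj a)) < 0"

text \<open>A morphism \<open>L \<otimes> L \<rightarrow> L\<close> of Hodge structures of bidegree \<open>(a, b)\<close>, given as a
  \<open>\<int>\<close>-bilinear map \<open>\<mu>\<close> together with its \<open>\<complex>\<close>-bilinear extension \<open>\<mu>C\<close>.\<close>

definition hodge_product ::
  "(int, 'l) module \<Rightarrow> (complex, 'v) module \<Rightarrow> ('l \<Rightarrow> 'v) \<Rightarrow> (int \<Rightarrow> int \<Rightarrow> 'v set) \<Rightarrow>
   int \<Rightarrow> int \<Rightarrow> ('l \<Rightarrow> 'l \<Rightarrow> 'l) \<Rightarrow> ('v \<Rightarrow> 'v \<Rightarrow> 'v) \<Rightarrow> bool" where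
  "hodge_product L V \<iota> F a b \<mu> \<mu>C \<longleftrightarrow>
     bilinear_map L L L \<mu> \<and> bilinear_map V V V \<mu>C \<and>
     (\<forall>x\<in>carrier L. \<forall>y\<in>carrier L. \<iota> (\<mu> x y) = \<mu>C (\<iota> x) (\<iota> y)) \<and>
     (\<forall>p q r s. \<forall>x\<in>F p q. \<forall>y\<in>F r s. \<mu>C x y \<in> F (p + r + a) (q + s + b))"


section \<open>Tensor, Clifford and exterior algebras\<close>

instantiation list :: (type) monoid_add
begin

definition zero_list :: "'a list" where "zero_list = []"

definition plus_list :: "'a list \<Rightarrow> 'a list \<Rightarrow> 'a list" where "plus_list = (@)"

instance by standard (simp_all add: zero_list_def plus_list_def)

end

text \<open>With concatenation as the addition of exponents, the ring \<^typ>\<open>'m list \<Rightarrow>\<^sub>0 'r\<close> is the free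
  associative \<open>'r\<close>-algebra on the set \<open>'m\<close>; \<open>Poly_Mapping.single w c\<close> is \<open>c\<close> times the word \<open>w\<close>.\<close>

definition free_algebra :: "('r::comm_ring_1, 'm list \<Rightarrow>\<^sub>0 'r) module" where
  "free_algebra = \<lparr>carrier = UNIV, mult = (*), one = 1, zero = 0, add = (+),
     smult = (\<lambda>c p. Poly_Mapping.single [] c * p)\<rparr>"

abbreviation word :: "'m list \<Rightarrow> ('m list \<Rightarrow>\<^sub>0 'r::comm_ring_1)" where
  "word w \<equiv> Poly_Mapping.single w 1"

definition quotient_algebra :: "('r, 'a) module \<Rightarrow> 'a set \<Rightarrow> ('r, 'a set) module" where
  "quotient_algebra A I =
     \<lparr>carrier = carrier (A Quot I), mult = mult (A Quot I), one = one (A Quot I),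
      zero = zero (A Quot I), add = add (A Quot I),
      smult = (\<lambda>c X. (I +>\<^bsub>A\<^esub> (c \<odot>\<^bsub>A\<^esub> \<one>\<^bsub>A\<^esub>)) \<otimes>\<^bsub>A Quot I\<^esub> X)\<rparr>"

text \<open>The tensor algebra of the \<open>'r\<close>-module \<open>'m\<close> with scalar multiplication \<open>s\<close>.\<close>

definition tensor_ideal :: "('r::comm_ring_1 \<Rightarrow> 'm \<Rightarrow> 'm::ab_group_add) \<Rightarrow> ('m list \<Rightarrow>\<^sub>0 'r) set" where
  "tensor_ideal s = Idl\<^bsub>free_algebra\<^esub>
     ({word [x + y] - word [x] - word [y] | x y. True} \<union>
      {word [s c x] - Poly_Mapping.single [x] c | c x. True})"

definition tensor_algebra ::
  "('r::comm_ring_1 \<Rightarrow> 'm \<Rightarrow> 'm::ab_group_add) \<Rightarrow> ('r, ('m list \<Rightarrow>\<^sub>0 'r) set) module" where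
  "tensor_algebra s = quotient_algebra free_algebra (tensor_ideal s)"

definition tensor_class ::
  "('r::comm_ring_1 \<Rightarrow> 'm \<Rightarrow> 'm::ab_group_add) \<Rightarrow> ('m list \<Rightarrow>\<^sub>0 'r) \<Rightarrow> ('m list \<Rightarrow>\<^sub>0 'r) set" where
  "tensor_class s p = tensor_ideal s +>\<^bsub>free_algebra\<^esub> p"

definition clifford_ideal ::
  "('r::comm_ring_1 \<Rightarrow> 'm \<Rightarrow> 'm::ab_group_add) \<Rightarrow> ('m \<Rightarrow> 'm \<Rightarrow> 'r) \<Rightarrow> ('m list \<Rightarrow>\<^sub>0 'r) set set" where
  "clifford_ideal s B = (let T = tensor_algebra s; t = (\<lambda>x. tensor_class s (word [x])) in
     Idl\<^bsub>T\<^esub> {t x \<otimes>\<^bsub>T\<^esub> t x \<oplus>\<^bsub>T\<^esub> B x x \<odot>\<^bsub>T\<^esub> \<one>\<^bsub>T\<^esub> | x. True})"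

definition clifford_algebra ::
  "('r::comm_ring_1 \<Rightarrow> 'm \<Rightarrow> 'm::ab_group_add) \<Rightarrow> ('m \<Rightarrow> 'm \<Rightarrow> 'r) \<Rightarrow>
   ('r, ('m list \<Rightarrow>\<^sub>0 'r) set set) module" where
  "clifford_algebra s B = quotient_algebra (tensor_algebra s) (clifford_ideal s B)"

definition clifford_class ::
  "('r::comm_ring_1 \<Rightarrow> 'm \<Rightarrow> 'm::ab_group_add) \<Rightarrow> ('m \<Rightarrow> 'm \<Rightarrow> 'r) \<Rightarrow>
   ('m list \<Rightarrow>\<^sub>0 'r) \<Rightarrow> ('m list \<Rightarrow>\<^sub>0 'r) set set" where
  "clifford_class s B p = clifford_ideal s B +>\<^bsub>tensor_algebra s\<^esub> tensor_class s p"

text \<open>The exterior algebra is the quotient of the tensor algebra by the relations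
  \<open>x \<otimes> x = 0\<close>, that is, the Clifford algebra of the zero form.\<close>

abbreviation exterior_algebra ::
  "('r::comm_ring_1 \<Rightarrow> 'm \<Rightarrow> 'm::ab_group_add) \<Rightarrow> ('r, ('m list \<Rightarrow>\<^sub>0 'r) set set) module" where
  "exterior_algebra s \<equiv> clifford_algebra s (\<lambda>_ _. 0)"

abbreviation exterior_class ::
  "('r::comm_ring_1 \<Rightarrow> 'm \<Rightarrow> 'm::ab_group_add) \<Rightarrow> ('m list \<Rightarrow>\<^sub>0 'r) \<Rightarrow> ('m list \<Rightarrow>\<^sub>0 'r) set set" where
  "exterior_class s \<equiv> clifford_class s (\<lambda>_ _. 0)"

text \<open>A representative in the free algebra of an element of the Clifford algebra. All maps below
  that are applied to representatives descend to the quotients.\<close>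

definition representative ::
  "('r::comm_ring_1 \<Rightarrow> 'm \<Rightarrow> 'm::ab_group_add) \<Rightarrow> ('m \<Rightarrow> 'm \<Rightarrow> 'r) \<Rightarrow>
   ('m list \<Rightarrow>\<^sub>0 'r) set set \<Rightarrow> ('m list \<Rightarrow>\<^sub>0 'r)" where
  "representative s B X = (SOME p. clifford_class s B p = X)"


section \<open>The identification of the Clifford algebra with the exterior algebra\<close>

definition linear_extension ::
  "('m list \<Rightarrow> ('m list \<Rightarrow>\<^sub>0 'r)) \<Rightarrow> ('m list \<Rightarrow>\<^sub>0 'r::comm_ring_1) \<Rightarrow> ('m list \<Rightarrow>\<^sub>0 'r)" where
  "linear_extension f p =
     (\<Sum>w\<in>Poly_Mapping.keys p. Poly_Mapping.single [] (Poly_Mapping.lookup p w) * f w)"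

text \<open>Contraction with \<open>B h _\<close> is the antiderivation of the exterior algebra determined by
  \<open>h \<lrcorner> x = B h x\<close>, here lifted to the free algebra.\<close>

primrec contract_word :: "('m \<Rightarrow> 'm \<Rightarrow> 'r::comm_ring_1) \<Rightarrow> 'm \<Rightarrow> 'm list \<Rightarrow> ('m list \<Rightarrow>\<^sub>0 'r)" where
  "contract_word B h [] = 0"
| "contract_word B h (x # w) = Poly_Mapping.single w (B h x) - word [x] * contract_word B h w"

definition contract :: "('m \<Rightarrow> 'm \<Rightarrow> 'r::comm_ring_1) \<Rightarrow> 'm \<Rightarrow> ('m list \<Rightarrow>\<^sub>0 'r) \<Rightarrow> ('m list \<Rightarrow>\<^sub>0 'r)" where
  "contract B h = linear_extension (contract_word B h)"

text \<open>The identification sends \<open>1\<close> to \<open>1\<close> and turns left Clifford multiplication by \<open>h\<close> into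
  \<open>h \<and> _ - h \<lrcorner> _\<close>.\<close>

primrec symbol_word :: "('m \<Rightarrow> 'm \<Rightarrow> 'r::comm_ring_1) \<Rightarrow> 'm list \<Rightarrow> ('m list \<Rightarrow>\<^sub>0 'r)" where
  "symbol_word B [] = 1"
| "symbol_word B (h # w) = word [h] * symbol_word B w - contract B h (symbol_word B w)"

definition to_exterior ::
  "('r::comm_ring_1 \<Rightarrow> 'm \<Rightarrow> 'm::ab_group_add) \<Rightarrow> ('m \<Rightarrow> 'm \<Rightarrow> 'r) \<Rightarrow>
   ('m list \<Rightarrow>\<^sub>0 'r) set set \<Rightarrow> ('m list \<Rightarrow>\<^sub>0 'r) set set" where
  "to_exterior s B X = exterior_class s (linear_extension (symbol_word B) (representative s B X))"


section \<open>The Hodge structure on the Clifford algebra\<close>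

text \<open>The map of Clifford algebras induced by an additive map \<open>f\<close> of modules that is semilinear
  with respect to a ring homomorphism \<open>g\<close> and compatible with the forms. It is used for the
  inclusion \<open>C(H) \<rightarrow> C(H) \<otimes> \<complex>\<close> and for the conjugation on \<open>C(H) \<otimes> \<complex>\<close>.\<close>

definition free_map ::
  "('r \<Rightarrow> 'r') \<Rightarrow> ('m \<Rightarrow> 'm') \<Rightarrow> ('m list \<Rightarrow>\<^sub>0 'r::comm_ring_1) \<Rightarrow> ('m' list \<Rightarrow>\<^sub>0 'r'::comm_ring_1)" where
  "free_map g f p =
     (\<Sum>w\<in>Poly_Mapping.keys p. Poly_Mapping.single (map f w) (g (Poly_Mapping.lookup p w)))"

definition clifford_map ::
  "('r::comm_ring_1 \<Rightarrow> 'm \<Rightarrow> 'm::ab_group_add) \<Rightarrow> ('m \<Rightarrow> 'm \<Rightarrow> 'r) \<Rightarrow>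
   ('r'::comm_ring_1 \<Rightarrow> 'm' \<Rightarrow> 'm'::ab_group_add) \<Rightarrow> ('m' \<Rightarrow> 'm' \<Rightarrow> 'r') \<Rightarrow>
   ('r \<Rightarrow> 'r') \<Rightarrow> ('m \<Rightarrow> 'm') \<Rightarrow> ('m list \<Rightarrow>\<^sub>0 'r) set set \<Rightarrow> ('m' list \<Rightarrow>\<^sub>0 'r') set set" where
  "clifford_map s B s' B' g f X = clifford_class s' B' (free_map g f (representative s B X))"

text \<open>For subspaces \<open>W\<^sub>1, \<dots>, W\<^sub>k\<close> of the module, the subspace \<open>W\<^sub>1 \<and> \<dots> \<and> W\<^sub>k\<close> of the
  exterior algebra.\<close>

definition wedge ::
  "('r::comm_ring_1 \<Rightarrow> 'm \<Rightarrow> 'm::ab_group_add) \<Rightarrow> 'm set list \<Rightarrow> ('m list \<Rightarrow>\<^sub>0 'r) set set set" where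
  "wedge s Ws = span_of (exterior_algebra s) ((\<lambda>w. exterior_class s (word w)) ` listset Ws)"

text \<open>The sum over all \<open>k\<close> of the parts of type \<open>(p, q)\<close> of the \<open>k\<close>-th exterior powers;
  a factor with exponent \<open>k - 1\<close> occurs only for \<open>k \<ge> 1\<close>, and one with exponent \<open>k - 2\<close> only
  for \<open>k \<ge> 2\<close>.\<close>

definition exterior_hodge ::
  "(complex \<Rightarrow> 'v \<Rightarrow> 'v::ab_group_add) \<Rightarrow> (int \<Rightarrow> int \<Rightarrow> 'v set) \<Rightarrow> int \<Rightarrow> int \<Rightarrow>
   ('v list \<Rightarrow>\<^sub>0 complex) set set set" where
  "exterior_hodge s F p q =
     (if (p, q) = (2, 0) then
        span_of (exterior_algebra s) (\<Union>k\<in>{1..}. wedge s (F 2 0 # replicate (k - 1) (F 1 1)))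
      else if (p, q) = (0, 2) then
        span_of (exterior_algebra s) (\<Union>k\<in>{1..}. wedge s (F 0 2 # replicate (k - 1) (F 1 1)))
      else if (p, q) = (1, 1) then
        span_of (exterior_algebra s)
          ((\<Union>k. wedge s (replicate k (F 1 1))) \<union>
           (\<Union>k\<in>{2..}. wedge s (F 2 0 # F 0 2 # replicate (k - 2) (F 1 1))))
      else {\<zero>\<^bsub>exterior_algebra s\<^esub>})"

definition clifford_hodge ::
  "(complex \<Rightarrow> 'v \<Rightarrow> 'v::ab_group_add) \<Rightarrow> ('v \<Rightarrow> 'v \<Rightarrow> complex) \<Rightarrow> (int \<Rightarrow> int \<Rightarrow> 'v set) \<Rightarrow>
   int \<Rightarrow> int \<Rightarrow> ('v list \<Rightarrow>\<^sub>0 complex) set set set" where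
  "clifford_hodge s B F p q =
     {X \<in> carrier (clifford_algebra s B). to_exterior s B X \<in> exterior_hodge s F p q}"

end

theory Submission
  imports Defs
begin

text \<open>On \<open>V = L \<otimes> \<complex>\<close> let \<open>D\<close> act on the part of type \<open>(p, q)\<close> as multiplication by \<open>(p - q) / 2\<close>.
  Since \<open>D\<close> is skew for the form, it extends to derivations of the Clifford and of the exterior
  algebra, and the identification of the two commutes with them. As \<open>dim H\<^sup>2\<^sup>,\<^sup>0 = 1\<close>, two factors
  of type \<open>(2, 0)\<close> wedge to zero, so the exterior algebra is the sum of the eigenspaces of \<open>D\<close> for
  \<open>1\<close>, \<open>0\<close>, \<open>- 1\<close>, which are the parts of type \<open>(2, 0)\<close>, \<open>(1, 1)\<close>, \<open>(0, 2)\<close>. Hence the parts of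
  the Clifford algebra are eigenspaces of a derivation: eigenvalues add under multiplication, and
  conjugation changes their sign. Everything is computed on representatives in the free algebra,
  where the identification and its inverse (the same map for the form \<open>- B\<close>) are exact inverses.\<close>

section \<open>Calculus in the free algebra\<close>

text \<open>Types on the Clifford algebra are defined through the exterior algebra, but the
  identification of the two is not multiplicative, so a product cannot be followed through it. A
  derivation can: it is given by its values on letters, and it commutes with the identification as
  soon as it leaves the form invariant. That invariance is the orthogonality of the decomposition:
  the form pairs type (p, q) only with type (q, p), and there the eigenvalues of \<open>D\<close>
  cancel. On the line p + q = 2 the normalization (p - q) / 2 equals p - 1, so that adding
  eigenvalues, (p - 1) + (r - 1) = (p + r - 1) - 1, is precisely bidegree (-1, -1). A product of two
  elements of type (2, 0) has to vanish; the dimension hypothesis ensures this by excluding the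
  eigenvalues 2 and - 2. Elements of the algebras are cosets of cosets, and maps on them go through
  chosen representatives. The work is therefore split into exact identities in the free algebra and
  the check that each operator respects the ideal of relations.\<close>

definition scale :: "'r::comm_ring_1 \<Rightarrow> ('m list \<Rightarrow>\<^sub>0 'r) \<Rightarrow> ('m list \<Rightarrow>\<^sub>0 'r)" where
  "scale c p = Poly_Mapping.single [] c * p"

text \<open>Coefficients are central although letters do not commute; this lets \<open>scale\<close>
  slide out of every factor.\<close>

lemma single_Nil_commute: "p * Poly_Mapping.single [] c = Poly_Mapping.single [] (c::'r::comm_ring_1) * p"
proof (induction p rule: update_induct)
  case const
  show ?case by simp
next
  case (update f a b)
  have "Poly_Mapping.update a b f = f + Poly_Mapping.single a b"
    by (rule poly_mapping_eqI)
      (use update.hyps in \<open>auto simp: lookup_update lookup_add lookup_single when_def in_keys_iff\<close>)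
  then show ?case
    using update.IH by (simp add: distrib_left distrib_right mult_single plus_list_def mult.commute)
qed

lemma mult_scale_right [simp]: "p * scale c q = scale c (p * q)"
  unfolding scale_def by (metis mult.assoc single_Nil_commute)

lemma scale_mult_left [simp]: "scale c p * q = scale c (p * q)"
  by (simp add: scale_def mult.assoc)

lemma scale_add [simp]: "scale c (p + q) = scale c p + scale c q"
  and scale_diff [simp]: "scale c (p - q) = scale c p - scale c q"
  and scale_minus [simp]: "scale c (- p) = - scale c p"
  and scale_zero [simp]: "scale c 0 = 0"
  and scale_0 [simp]: "scale 0 p = 0"
  by (simp_all add: scale_def algebra_simps)

lemma scale_1 [simp]: "scale 1 p = p"
  unfolding scale_def by (metis mult_1 single_one zero_list_def)

lemma scale_add_left: "scale (c + d) p = scale c p + scale d p"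
  and scale_diff_left: "scale (c - d) p = scale c p - scale d p"
  and scale_minus_left [simp]: "scale (- c) p = - scale c p"
  by (simp_all add: scale_def single_add single_diff single_uminus algebra_simps)

lemma scale_scale [simp]: "scale c (scale d p) = scale (c * d) p"
  by (simp add: scale_def mult_single plus_list_def mult.assoc [symmetric])

lemma scale_sum: "scale c (sum f A) = (\<Sum>x\<in>A. scale c (f x))"
  by (simp add: scale_def sum_distrib_left)

lemma word_mult [simp]: "word u * word v = word (u @ v)"
  by (simp add: mult_single plus_list_def)

lemma word_mult' [simp]: "word u * (word v * p) = word (u @ v) * p"
  by (simp add: mult.assoc [symmetric])

lemma single_eq_scale: "Poly_Mapping.single w c = scale c (word w)"
  by (simp add: scale_def mult_single plus_list_def)

lemma word_Nil [simp]: "word [] = 1"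
  by (metis single_one zero_list_def)

text \<open>The letter case prepends one letter to an arbitrary element, which matches the
  recursions of \<open>contract_word\<close>, \<open>symbol_word\<close> and
  \<open>derive_word\<close>. An identity between such operators then follows from their rules on
  \<open>word [x] * p\<close>.\<close>

lemma free_algebra_induct [case_names one add scale word]:
  assumes one: "P 1"
    and add: "\<And>p q. P p \<Longrightarrow> P q \<Longrightarrow> P (p + q)"
    and scale: "\<And>c p. P p \<Longrightarrow> P (scale c p)"
    and word: "\<And>x p. P p \<Longrightarrow> P (word [x] * p)"
  shows "P p"
proof (induction p rule: update_induct)
  case const
  show ?case using scale [OF one, of 0] by simp
next
  case (update f a b)
  have w: "P (word w)" for w
  proof (induction w)
    case Nil
    show ?case using one by simp
  next
    case (Cons x w)
    then show ?case using word [of "word w" x] by simp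
  qed
  have "Poly_Mapping.update a b f = f + Poly_Mapping.single a b"
    by (rule poly_mapping_eqI)
      (use update.hyps in \<open>auto simp: lookup_update lookup_add lookup_single when_def in_keys_iff\<close>)
  then show ?case
    using update.IH w by (simp add: single_eq_scale [of a b] add scale)
qed

lemma linear_extension_scale_eq:
  "linear_extension f p = (\<Sum>w\<in>Poly_Mapping.keys p. scale (Poly_Mapping.lookup p w) (f w))"
  by (simp add: linear_extension_def scale_def)

lemma linear_extension_add [simp]:
  "linear_extension f (p + q) = linear_extension f p + linear_extension f q"
  unfolding linear_extension_scale_eq
  by (rule setsum_keys_plus_distrib) (simp_all add: scale_add_left)

lemma linear_extension_zero [simp]: "linear_extension f 0 = 0"
  by (simp add: linear_extension_def)

lemma linear_extension_minus [simp]: "linear_extension f (- p) = - linear_extension f p"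
  by (metis add.right_inverse add_eq_0_iff linear_extension_add linear_extension_zero)

lemma linear_extension_diff [simp]:
  "linear_extension f (p - q) = linear_extension f p - linear_extension f q"
  by (metis diff_conv_add_uminus linear_extension_add linear_extension_minus)

lemma linear_extension_single: "linear_extension f (Poly_Mapping.single w c) = scale c (f w)"
  by (simp add: linear_extension_scale_eq)

lemma linear_extension_word [simp]: "linear_extension f (word w) = f w"
  by (simp add: linear_extension_single)

lemma linear_extension_one [simp]: "linear_extension f 1 = f []"
  by (metis linear_extension_word word_Nil)

text \<open>Having no letter case, this induction serves to derive the rules on
  \<open>word [x] * p\<close> themselves from the values on words.\<close>

lemma scale_induct_word [case_names add single]:
  assumes "\<And>p q. P p \<Longrightarrow> P q \<Longrightarrow> P (p + q)" "\<And>w c. P (scale c (word w))"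
  shows "P p"
proof -
  \<comment> \<open>Carrying a prefix \<open>u\<close> and a coefficient \<open>c\<close> absorbs
    the letter and scalar cases, under which \<open>P\<close> is not assumed to be stable.\<close>
  have "\<forall>u c. P (scale c (word u * p))"
  proof (induction p rule: free_algebra_induct)
    case one
    then show ?case using assms(2) by simp
  next
    case (add p q)
    then show ?case using assms(1) by (simp add: distrib_left)
  next
    case (scale c p)
    then show ?case by simp
  next
    case (word x p)
    then show ?case by simp
  qed
  then have "P (scale 1 (word [] * p))" by blast
  then show ?thesis by simp
qed

lemma linear_extension_scale [simp]: "linear_extension f (scale c p) = scale c (linear_extension f p)"
proof (induction p rule: scale_induct_word)
  case (single w d)
  have "linear_extension f (scale a (word w)) = scale a (f w)" for a
    by (metis linear_extension_single single_eq_scale)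
  then show ?case by simp
qed simp

subsection \<open>Contractions\<close>

lemma contract_linear [simp]:
  "contract B h (p + q) = contract B h p + contract B h q"
  "contract B h (p - q) = contract B h p - contract B h q"
  "contract B h (- p) = - contract B h p"
  "contract B h (scale c p) = scale c (contract B h p)"
  "contract B h 0 = 0" "contract B h 1 = 0"
  by (simp_all add: contract_def)

lemma contract_word_mult [simp]:
  "contract B h (word [x] * p) = scale (B h x) p - word [x] * contract B h p"
proof (induction p rule: scale_induct_word)
  case (add p q)
  then show ?case by (simp add: algebra_simps)
next
  case (single w c)
  then show ?case
    by (simp add: contract_def single_eq_scale [where c = "B h x"] mult.commute)
qed

lemma contract_square [simp]: "contract B h (contract B h p) = 0"
  by (induction p rule: free_algebra_induct) (simp_all add: algebra_simps)

text \<open>Contractions are odd antiderivations, so their anticommutator is an even derivation, and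
  it kills every letter. This holds even for two different forms.\<close>

lemma contract_anticommute: "contract B h (contract E k p) = - contract E k (contract B h p)"
  by (induction p rule: free_algebra_induct) (simp_all add: algebra_simps)

lemma contract_form_add:
  assumes "\<And>y. B (x + x') y = B x y + B x' y"
  shows "contract B (x + x') p = contract B x p + contract B x' p"
  by (induction p rule: free_algebra_induct) (simp_all add: assms scale_add_left algebra_simps)

lemma contract_form_scale:
  assumes "\<And>y. B x' y = c * B x y"
  shows "contract B x' p = scale c (contract B x p)"
  by (induction p rule: free_algebra_induct) (simp_all add: assms algebra_simps)

lemma contract_uminus_form: "contract (\<lambda>x y. - B x y) h p = - contract B h p"
  by (induction p rule: free_algebra_induct) (simp_all add: algebra_simps)

subsection \<open>The symbol map\<close>

definition symbol :: "('m \<Rightarrow> 'm \<Rightarrow> 'r::comm_ring_1) \<Rightarrow> ('m list \<Rightarrow>\<^sub>0 'r) \<Rightarrow> ('m list \<Rightarrow>\<^sub>0 'r)" where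
  "symbol B = linear_extension (symbol_word B)"

lemma symbol_linear [simp]:
  "symbol B (p + q) = symbol B p + symbol B q"
  "symbol B (p - q) = symbol B p - symbol B q"
  "symbol B (- p) = - symbol B p"
  "symbol B (scale c p) = scale c (symbol B p)"
  "symbol B 0 = 0" "symbol B 1 = 1"
  by (simp_all add: symbol_def)

lemma symbol_word_mult [simp]:
  "symbol B (word [x] * p) = word [x] * symbol B p - contract B x (symbol B p)"
  by (induction p rule: scale_induct_word) (simp_all add: symbol_def algebra_simps)

text \<open>Contraction with \<open>k\<close> anticommutes with multiplication by \<open>x\<close>
  up to the scalar \<open>E k x\<close>, and it anticommutes with \<open>contract B x\<close>.
  Replacing multiplication by \<open>x\<close> with multiplication minus contraction thus leaves the
  rule for \<open>contract E k\<close> unchanged.\<close>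

lemma contract_symbol: "contract E k (symbol B p) = symbol B (contract E k p)"
  by (induction p rule: free_algebra_induct)
    (simp_all add: algebra_simps contract_anticommute [of E k B])

text \<open>In the letter case the outer map adds the contraction that the inner map has subtracted,
  because \<open>contract_symbol\<close> moves it past the outer map. No relation between letters is
  used.\<close>

lemma symbol_inverse: "symbol (\<lambda>x y. - B x y) (symbol B p) = p"
proof (induction p rule: free_algebra_induct)
  case (word x p)
  then show ?case
    by (simp add: contract_uminus_form flip: contract_symbol)
qed simp_all

lemma symbol_inverse': "symbol B (symbol (\<lambda>x y. - B x y) p) = p"
  using symbol_inverse [of "\<lambda>x y. - B x y"] by simp

subsection \<open>Derivations\<close>

primrec derive_word :: "('m \<Rightarrow> 'm) \<Rightarrow> 'm list \<Rightarrow> ('m list \<Rightarrow>\<^sub>0 'r::comm_ring_1)" where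
  "derive_word D [] = 0"
| "derive_word D (x # w) = word (D x # w) + word [x] * derive_word D w"

definition derivation :: "('m \<Rightarrow> 'm) \<Rightarrow> ('m list \<Rightarrow>\<^sub>0 'r::comm_ring_1) \<Rightarrow> ('m list \<Rightarrow>\<^sub>0 'r)" where
  "derivation D = linear_extension (derive_word D)"

lemma derivation_linear [simp]:
  "derivation D (p + q) = derivation D p + derivation D q"
  "derivation D (p - q) = derivation D p - derivation D q"
  "derivation D (- p) = - derivation D p"
  "derivation D (scale c p) = scale c (derivation D p)"
  "derivation D 0 = 0" "derivation D 1 = 0"
  by (simp_all add: derivation_def)

lemma derivation_word_mult [simp]:
  "derivation D (word [x] * p) = word [D x] * p + word [x] * derivation D p"
  by (induction p rule: scale_induct_word) (simp_all add: derivation_def algebra_simps)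

lemma derivation_word1 [simp]: "derivation D (word [x]) = word [D x]"
  by (metis add_0_right derivation_linear(6) derivation_word_mult mult_1_right mult_zero_right)

lemma derivation_mult: "derivation D (p * q) = derivation D p * q + p * derivation D q"
proof (induction p rule: free_algebra_induct)
  case (word x p)
  have "derivation D (word [x] * (p * q)) = word [D x] * (p * q) + word [x] * derivation D (p * q)"
    by (rule derivation_word_mult)
  then show ?case using word by (simp add: algebra_simps)
qed (simp_all add: algebra_simps)

text \<open>A Leibniz rule for the pairing of \<open>h\<close> with \<open>p\<close>: the scalars
  \<open>B (D h) x\<close> and \<open>B h (D x)\<close> produced by a letter \<open>x\<close> cancel
  by skewness.\<close>

lemma derivation_contract:
  assumes "\<And>x y. B (D x) y = - B x (D y)"
  shows "derivation D (contract B h p) = contract B (D h) p + contract B h (derivation D p)"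
  by (induction p rule: free_algebra_induct) (simp_all add: assms algebra_simps)

lemma derivation_symbol:
  assumes "\<And>x y. B (D x) y = - B x (D y)"
  shows "derivation D (symbol B p) = symbol B (derivation D p)"
  by (induction p rule: free_algebra_induct)
    (simp_all add: derivation_contract [of B D, OF assms] algebra_simps)

subsection \<open>Semilinear substitutions\<close>

locale ring_hom1 =
  fixes g :: "'r::comm_ring_1 \<Rightarrow> 'r'::comm_ring_1"
  assumes hom_add: "g (a + b) = g a + g b" and hom_mult: "g (a * b) = g a * g b"
    and hom_one: "g 1 = 1"
begin

lemma hom_zero: "g 0 = 0"
  using hom_add [of 0 0] by simp

lemma free_map_add [simp]: "free_map g f (p + q) = free_map g f p + free_map g f q"
  unfolding free_map_def
  by (rule setsum_keys_plus_distrib) (simp_all add: hom_zero hom_add single_add)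

lemma free_map_scale_word: "free_map g f (scale c (word w)) = scale (g c) (word (map f w))"
proof -
  have "free_map g f (Poly_Mapping.single w c) = Poly_Mapping.single (map f w) (g c)"
    by (simp add: free_map_def hom_zero)
  then show ?thesis by (metis single_eq_scale)
qed

lemma free_map_word [simp]: "free_map g f (word w) = word (map f w)"
  using free_map_scale_word [of f 1] by (simp add: hom_one)

lemma free_map_one [simp]: "free_map g f 1 = 1"
  using free_map_word [of f "[]"] by simp

lemma free_map_scale [simp]: "free_map g f (scale c p) = scale (g c) (free_map g f p)"
  by (induction p rule: scale_induct_word) (simp_all add: free_map_scale_word hom_mult)

lemma free_map_zero [simp]: "free_map g f 0 = 0"
  by (simp add: free_map_def)

lemma free_map_minus [simp]: "free_map g f (- p) = - free_map g f p"
  by (metis add.right_inverse add_eq_0_iff free_map_add free_map_zero)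

lemma free_map_diff [simp]: "free_map g f (p - q) = free_map g f p - free_map g f q"
  by (metis diff_conv_add_uminus free_map_add free_map_minus)

lemma free_map_word_mult [simp]: "free_map g f (word [x] * p) = word [f x] * free_map g f p"
  by (induction p rule: scale_induct_word)
    (simp_all add: free_map_scale_word algebra_simps)

lemma free_map_mult [simp]: "free_map g f (p * q) = free_map g f p * free_map g f q"
  by (induction p rule: free_algebra_induct) (simp_all add: algebra_simps mult.assoc)

end

section \<open>The Clifford algebra as a quotient of the free algebra\<close>

text \<open>The relations of the tensor algebra and those of the Clifford algebra stand in one list,
  so that the quotient of a quotient can be handled as a single quotient of the free
  algebra.\<close>

inductive relator ::
  "('r::comm_ring_1 \<Rightarrow> 'm \<Rightarrow> 'm::ab_group_add) \<Rightarrow> ('m \<Rightarrow> 'm \<Rightarrow> 'r) \<Rightarrow> ('m list \<Rightarrow>\<^sub>0 'r) \<Rightarrow> bool"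
  for s B where
  additive: "relator s B (word [x + y] - word [x] - word [y])"
| homogeneous: "relator s B (word [s c x] - scale c (word [x]))"
| square: "relator s B (word [x, x] + scale (B x x) 1)"

text \<open>The preimage of \<open>0\<close> under the projection from the free algebra to the Clifford algebra. It is
  generated one letter at a time from the left, so that inductions only meet words \<open>word [x]\<close>.\<close>

inductive_set null_ideal ::
  "('r::comm_ring_1 \<Rightarrow> 'm \<Rightarrow> 'm::ab_group_add) \<Rightarrow> ('m \<Rightarrow> 'm \<Rightarrow> 'r) \<Rightarrow> ('m list \<Rightarrow>\<^sub>0 'r) set"
  for s B where
  relator: "relator s B r \<Longrightarrow> r * q \<in> null_ideal s B"
| left: "p \<in> null_ideal s B \<Longrightarrow> word [x] * p \<in> null_ideal s B"
| add: "p \<in> null_ideal s B \<Longrightarrow> q \<in> null_ideal s B \<Longrightarrow> p + q \<in> null_ideal s B"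

lemmas null_ideal_add = null_ideal.add

lemma relator_null:
  assumes "relator s B r" shows "r \<in> null_ideal s B"
  using null_ideal.relator [OF assms, where q = 1] by simp

lemma null_ideal_zero [simp]: "0 \<in> null_ideal s B"
proof -
  have "(word [0 + 0] - word [0] - word [0]) * 0 \<in> null_ideal s B"
    by (intro null_ideal.relator relator.additive)
  then show ?thesis by simp
qed

lemma null_ideal_scale: "p \<in> null_ideal s B \<Longrightarrow> scale c p \<in> null_ideal s B"
proof (induction rule: null_ideal.induct)
  case (relator r q)
  then show ?case
    using null_ideal.relator [OF relator, where q = "scale c q"] by simp
next
  case (left p x)
  then show ?case
    using null_ideal.left [of "scale c p" s B x] by simp
qed (simp add: null_ideal_add)

lemma null_ideal_minus: "p \<in> null_ideal s B \<Longrightarrow> - p \<in> null_ideal s B"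
  using null_ideal_scale [of p s B "- 1"] by simp

lemma null_ideal_diff:
  assumes "p \<in> null_ideal s B" "q \<in> null_ideal s B"
  shows "p - q \<in> null_ideal s B"
  using null_ideal_add [OF assms(1) null_ideal_minus [OF assms(2)]] by simp

lemma null_ideal_left: "p \<in> null_ideal s B \<Longrightarrow> q * p \<in> null_ideal s B"
  by (induction q rule: free_algebra_induct)
    (simp_all add: distrib_right null_ideal_add null_ideal_scale null_ideal.left mult.assoc)

lemma null_ideal_right: "p \<in> null_ideal s B \<Longrightarrow> p * q \<in> null_ideal s B"
  by (induction rule: null_ideal.induct)
    (simp_all add: distrib_right null_ideal.intros mult.assoc)

lemma null_ideal_iff: "p - q \<in> null_ideal s B \<Longrightarrow> p \<in> null_ideal s B \<longleftrightarrow> q \<in> null_ideal s B"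
  using null_ideal_add [of "p - q" s B q] null_ideal_diff [of p s B "p - q"] by auto

section \<open>The two-stage quotient and its reduction to one ideal of the free algebra\<close>

lemma idealI':
  fixes R (structure)
  assumes "ring R" "I \<subseteq> carrier R" "\<zero> \<in> I"
    and add: "\<And>a b. a \<in> I \<Longrightarrow> b \<in> I \<Longrightarrow> a \<oplus> b \<in> I"
    and left: "\<And>a x. a \<in> I \<Longrightarrow> x \<in> carrier R \<Longrightarrow> x \<otimes> a \<in> I"
    and right: "\<And>a x. a \<in> I \<Longrightarrow> x \<in> carrier R \<Longrightarrow> a \<otimes> x \<in> I"
  shows "ideal I R"
proof -
  interpret ring R by fact
  \<comment> \<open>Negatives come from absorbing the ring element
    \<open>\<ominus> \<one>\<close>.\<close>
  have "\<ominus> a \<in> I" if "a \<in> I" for a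
    using left [OF that, of "\<ominus> \<one>"] that assms(2) by (auto simp: l_minus)
  then have "subgroup I (add_monoid R)"
    using assms(2,3) add by (intro subgroup.intro) (auto simp: a_inv_def)
  then show ?thesis
    using left right by (intro idealI) (simp_all add: ring_axioms)
qed

lemma ring_free_algebra: "ring free_algebra"
proof -
  have "\<exists>y. y + x = 0" for x :: "'m list \<Rightarrow>\<^sub>0 'r::comm_ring_1"
    by (rule exI [of _ "- x"]) simp
  then show ?thesis
    by (intro ringI abelian_groupI monoidI) (simp_all add: free_algebra_def algebra_simps)
qed

text \<open>Used for both stages: the tensor algebra over the free algebra, and the Clifford algebra
  over the tensor algebra. Scalars act through the class of a multiple of the unit, so the rule for
  them asks only that this multiple lies in the carrier.\<close>

lemma quotient_algebra:
  fixes A :: "('r, 'a) module"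
  assumes "ideal I A"
  defines "\<pi> \<equiv> \<lambda>x. I +>\<^bsub>A\<^esub> x" and "Q \<equiv> quotient_algebra A I"
  shows "ring Q" and "carrier Q = \<pi> ` carrier A" and "\<one>\<^bsub>Q\<^esub> = \<pi> \<one>\<^bsub>A\<^esub>" and "\<zero>\<^bsub>Q\<^esub> = \<pi> \<zero>\<^bsub>A\<^esub>"
    and "\<And>x y. x \<in> carrier A \<Longrightarrow> y \<in> carrier A \<Longrightarrow> \<pi> x \<otimes>\<^bsub>Q\<^esub> \<pi> y = \<pi> (x \<otimes>\<^bsub>A\<^esub> y)"
    and "\<And>x y. x \<in> carrier A \<Longrightarrow> y \<in> carrier A \<Longrightarrow> \<pi> x \<oplus>\<^bsub>Q\<^esub> \<pi> y = \<pi> (x \<oplus>\<^bsub>A\<^esub> y)"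
    and "\<And>c x. c \<odot>\<^bsub>A\<^esub> \<one>\<^bsub>A\<^esub> \<in> carrier A \<Longrightarrow> x \<in> carrier A \<Longrightarrow> c \<odot>\<^bsub>Q\<^esub> \<pi> x = \<pi> ((c \<odot>\<^bsub>A\<^esub> \<one>\<^bsub>A\<^esub>) \<otimes>\<^bsub>A\<^esub> x)"
    and "\<And>x y. x \<in> carrier A \<Longrightarrow> y \<in> carrier A \<Longrightarrow> \<pi> x = \<pi> y \<longleftrightarrow> x \<ominus>\<^bsub>A\<^esub> y \<in> I"
proof -
  interpret ideal I A by fact
  interpret hom: ring_hom_ring A "A Quot I" \<pi>
    unfolding \<pi>_def by (rule rcos_ring_hom_ring)
  show carrier: "carrier Q = \<pi> ` carrier A"
    by (auto simp: Q_def \<pi>_def quotient_algebra_def FactRing_simps)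
  show one: "\<one>\<^bsub>Q\<^esub> = \<pi> \<one>\<^bsub>A\<^esub>" and zero: "\<zero>\<^bsub>Q\<^esub> = \<pi> \<zero>\<^bsub>A\<^esub>"
    by (simp_all add: Q_def quotient_algebra_def)
  show mult: "\<pi> x \<otimes>\<^bsub>Q\<^esub> \<pi> y = \<pi> (x \<otimes>\<^bsub>A\<^esub> y)" if "x \<in> carrier A" "y \<in> carrier A" for x y
    using that by (simp add: Q_def quotient_algebra_def)
  show add: "\<pi> x \<oplus>\<^bsub>Q\<^esub> \<pi> y = \<pi> (x \<oplus>\<^bsub>A\<^esub> y)" if "x \<in> carrier A" "y \<in> carrier A" for x y
    using that by (simp add: Q_def quotient_algebra_def)
  show "c \<odot>\<^bsub>Q\<^esub> \<pi> x = \<pi> ((c \<odot>\<^bsub>A\<^esub> \<one>\<^bsub>A\<^esub>) \<otimes>\<^bsub>A\<^esub> x)"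
    if "c \<odot>\<^bsub>A\<^esub> \<one>\<^bsub>A\<^esub> \<in> carrier A" "x \<in> carrier A" for c x
    using that hom.hom_mult [OF that] by (simp add: Q_def quotient_algebra_def \<pi>_def)
  show "\<pi> x = \<pi> y \<longleftrightarrow> x \<ominus>\<^bsub>A\<^esub> y \<in> I" if "x \<in> carrier A" "y \<in> carrier A" for x y
    using quotient_eq_iff_same_a_r_cos [OF assms(1) that] by (simp add: \<pi>_def)
  have neg: "\<exists>y\<in>carrier A. \<pi> y \<oplus>\<^bsub>Q\<^esub> \<pi> x = \<pi> \<zero>\<^bsub>A\<^esub>" if "x \<in> carrier A" for x
    using that add [of "\<ominus>\<^bsub>A\<^esub> x" x] by (metis a_inv_closed l_neg)
  have neg': "\<exists>y\<in>carrier A. \<pi> (x \<oplus>\<^bsub>A\<^esub> y) = \<pi> \<zero>\<^bsub>A\<^esub>" if "x \<in> carrier A" for x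
    using that by (metis a_inv_closed r_neg)
  show "ring Q"
    by (intro ringI abelian_groupI monoidI)
      (auto simp: carrier one zero mult add a_assoc m_assoc l_distr r_distr neg neg' a_ac
        simp del: hom.hom_add hom.hom_mult hom.hom_zero hom.hom_one)
qed

context
  fixes s :: "'r::comm_ring_1 \<Rightarrow> 'm::ab_group_add \<Rightarrow> 'm"
begin

lemma ideal_tensor_ideal: "ideal (tensor_ideal s) free_algebra"
  unfolding tensor_ideal_def
  by (rule ring.genideal_ideal [OF ring_free_algebra]) (simp add: free_algebra_def)

lemma tensor_relator: "r \<in> tensor_ideal s"
  if "r \<in> {word [x + y] - word [x] - word [y] | x y. True} \<union>
      {word [s c x] - Poly_Mapping.single [x] c | c x. True}"
  unfolding tensor_ideal_def
  by (rule subsetD [OF ring.genideal_self [OF ring_free_algebra] that]) (simp add: free_algebra_def)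

lemma a_minus_free_algebra: "p \<ominus>\<^bsub>free_algebra\<^esub> q = p - q"
proof -
  interpret ring free_algebra by (rule ring_free_algebra)
  have "\<ominus>\<^bsub>free_algebra\<^esub> q = - q"
    by (rule minus_equality) (simp_all add: free_algebra_def)
  then show ?thesis
    by (simp add: a_minus_def) (simp add: free_algebra_def)
qed

lemma tensor_algebra:
  defines "T \<equiv> tensor_algebra s" and "t \<equiv> tensor_class s"
  shows "ring T" "carrier T = range t" "\<one>\<^bsub>T\<^esub> = t 1" "\<zero>\<^bsub>T\<^esub> = t 0"
    and "t p \<otimes>\<^bsub>T\<^esub> t q = t (p * q)" "t p \<oplus>\<^bsub>T\<^esub> t q = t (p + q)" "c \<odot>\<^bsub>T\<^esub> t p = t (scale c p)"
    and "t p = t q \<longleftrightarrow> p - q \<in> tensor_ideal s"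
  using quotient_algebra [OF ideal_tensor_ideal]
  by (simp_all add: T_def t_def tensor_algebra_def tensor_class_def [abs_def] a_minus_free_algebra
      scale_def) (simp_all add: free_algebra_def)

lemma a_minus_tensor_algebra:
  "tensor_class s p \<ominus>\<^bsub>tensor_algebra s\<^esub> tensor_class s q = tensor_class s (p - q)"
proof -
  interpret ring "tensor_algebra s" by (rule tensor_algebra)
  have "\<ominus>\<^bsub>tensor_algebra s\<^esub> tensor_class s q = tensor_class s (- q)"
    by (rule minus_equality) (simp_all add: tensor_algebra rangeI)
  then show ?thesis
    by (simp add: a_minus_def tensor_algebra)
qed

context
  fixes B :: "'m \<Rightarrow> 'm \<Rightarrow> 'r"
begin

lemma clifford_ideal_eq:
  "clifford_ideal s B =
    Idl\<^bsub>tensor_algebra s\<^esub> {tensor_class s (word [x, x] + scale (B x x) 1) | x. True}"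
  by (simp add: clifford_ideal_def Let_def tensor_algebra)

lemma ideal_clifford_ideal: "ideal (clifford_ideal s B) (tensor_algebra s)"
  unfolding clifford_ideal_eq
  by (rule ring.genideal_ideal [OF tensor_algebra(1)]) (auto simp: tensor_algebra)

lemma tensor_ideal_subset_null: "tensor_ideal s \<subseteq> null_ideal s B"
  unfolding tensor_ideal_def
proof (rule ring.genideal_minimal [OF ring_free_algebra])
  show "ideal (null_ideal s B) free_algebra"
    by (rule idealI' [OF ring_free_algebra])
      (simp_all add: free_algebra_def null_ideal_add null_ideal_left null_ideal_right)
  have "word [s c x] - Poly_Mapping.single [x] c \<in> null_ideal s B" for c x
    by (simp add: single_eq_scale [of "[x]" c] relator_null relator.homogeneous)
  then show "{word [x + y] - word [x] - word [y] |x y. True} \<union>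
      {word [s c x] - Poly_Mapping.single [x] c |c x. True} \<subseteq> null_ideal s B"
    using relator_null [OF relator.additive] by fast
qed

text \<open>Forwards, the image of \<open>null_ideal\<close> is an ideal of the tensor algebra
  containing the generators; since \<open>null_ideal\<close> contains the tensor ideal, membership
  does not depend on the chosen preimage. Backwards, each relator becomes zero in the tensor algebra
  or is one of the generators.\<close>

lemma clifford_ideal_iff: "tensor_class s p \<in> clifford_ideal s B \<longleftrightarrow> p \<in> null_ideal s B"
proof
  interpret ideal "clifford_ideal s B" "tensor_algebra s"
    by (rule ideal_clifford_ideal)
  have "clifford_ideal s B \<subseteq> tensor_class s ` null_ideal s B"
    unfolding clifford_ideal_eq
  proof (rule genideal_minimal)
    show "ideal (tensor_class s ` null_ideal s B) (tensor_algebra s)"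
      by (rule idealI' [OF ring_axioms])
        (auto simp: tensor_algebra intro: imageI null_ideal_add null_ideal_left null_ideal_right)
  qed (auto intro!: imageI relator_null relator.square)
  moreover assume "tensor_class s p \<in> clifford_ideal s B"
  ultimately obtain q where "q \<in> null_ideal s B" "tensor_class s p = tensor_class s q"
    by auto
  then show "p \<in> null_ideal s B"
    using tensor_ideal_subset_null null_ideal_iff by (metis subsetD tensor_algebra(8))
next
  interpret ideal "clifford_ideal s B" "tensor_algebra s"
    by (rule ideal_clifford_ideal)
  assume "p \<in> null_ideal s B"
  then show "tensor_class s p \<in> clifford_ideal s B"
  proof (induction rule: null_ideal.induct)
    case (relator r q)
    have zero: "tensor_class s r \<in> clifford_ideal s B" if "r \<in> tensor_ideal s" for r
      using that additive_subgroup.zero_closed [OF additive_subgroup_axioms]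
      by (metis diff_zero tensor_algebra(4,8))
    have "tensor_class s r \<in> clifford_ideal s B"
      using relator
    proof cases
      case (additive x y)
      then show ?thesis
        by (intro zero tensor_relator) auto
    next
      case (homogeneous c x)
      have "word [s c x] - Poly_Mapping.single [x] c \<in> tensor_ideal s"
        by (rule tensor_relator) auto
      then show ?thesis
        using single_eq_scale [of "[x]" c] by (intro zero) (simp add: homogeneous)
    next
      case (square x)
      then show ?thesis
        unfolding clifford_ideal_eq
        by (intro subsetD [OF genideal_self]) (auto simp: tensor_algebra(2))
    qed
    then show ?case
      using I_r_closed [of "tensor_class s r" "tensor_class s q"] by (simp add: tensor_algebra rangeI)
  next
    case (left p x)
    then show ?case
      using I_l_closed [of "tensor_class s p" "tensor_class s (word [x])"]
      by (simp add: tensor_algebra rangeI)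
  next
    case (add p q)
    then show ?case
      by (metis additive_subgroup.a_closed additive_subgroup_axioms tensor_algebra(6))
  qed
qed

lemma clifford_algebra:
  defines "C \<equiv> clifford_algebra s B" and "\<gamma> \<equiv> clifford_class s B"
  shows "ring C" "carrier C = range \<gamma>" "\<one>\<^bsub>C\<^esub> = \<gamma> 1" "\<zero>\<^bsub>C\<^esub> = \<gamma> 0"
    and "\<gamma> p \<otimes>\<^bsub>C\<^esub> \<gamma> q = \<gamma> (p * q)" "\<gamma> p \<oplus>\<^bsub>C\<^esub> \<gamma> q = \<gamma> (p + q)" "c \<odot>\<^bsub>C\<^esub> \<gamma> p = \<gamma> (scale c p)"
    and "\<gamma> p = \<gamma> q \<longleftrightarrow> p - q \<in> null_ideal s B"
  using quotient_algebra [OF ideal_clifford_ideal]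
  by (simp_all add: C_def \<gamma>_def clifford_algebra_def clifford_class_def [abs_def]
      a_minus_tensor_algebra clifford_ideal_iff tensor_algebra image_image rangeI)

lemma clifford_class_eq_iff:
  "clifford_class s B p = clifford_class s B q \<longleftrightarrow> p - q \<in> null_ideal s B"
  by (rule clifford_algebra)

lemma clifford_class_cases:
  assumes "X \<in> carrier (clifford_algebra s B)"
  obtains p where "X = clifford_class s B p"
  using assms by (auto simp: clifford_algebra)

lemma representative: "representative s B (clifford_class s B p) - p \<in> null_ideal s B"
proof -
  have "clifford_class s B (representative s B (clifford_class s B p)) = clifford_class s B p"
    unfolding representative_def by (rule someI) (rule refl)
  then show ?thesis by (simp add: clifford_class_eq_iff)
qed

section \<open>The Clifford algebra as a module, and its submodules\<close>

lemma cring_scalar_ring: "cring (scalar_ring :: 'a::comm_ring_1 ring)"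
proof -
  have "\<exists>y. y + x = 0" for x :: 'a
    by (rule exI [of _ "- x"]) simp
  then show ?thesis
    by (intro cringI abelian_groupI comm_monoidI) (simp_all add: scalar_ring_def algebra_simps)
qed

lemma module_clifford_algebra: "module scalar_ring (clifford_algebra s B)"
proof (rule moduleI)
  show "abelian_group (clifford_algebra s B)"
    using clifford_algebra(1) by (rule ring.axioms)
qed (auto simp: cring_scalar_ring clifford_algebra,
    simp_all add: scalar_ring_def clifford_algebra scale_add_left)

lemma bilinear_map_clifford_mult:
  "bilinear_map (clifford_algebra s B) (clifford_algebra s B) (clifford_algebra s B)
    (mult (clifford_algebra s B))"
  by (auto simp: bilinear_map_def clifford_algebra algebra_simps)

lemma submodule_clifford_class:
  assumes "0 \<in> P" "\<And>p q. p \<in> P \<Longrightarrow> q \<in> P \<Longrightarrow> p + q \<in> P" "\<And>c p. p \<in> P \<Longrightarrow> scale c p \<in> P"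
  shows "submodule (clifford_class s B ` P) scalar_ring (clifford_algebra s B)"
proof (rule module.submoduleI [OF module_clifford_algebra])
  interpret ring "clifford_algebra s B" by (rule clifford_algebra)
  fix X assume "X \<in> clifford_class s B ` P"
  then obtain p where p: "p \<in> P" "X = clifford_class s B p" by auto
  have "\<ominus>\<^bsub>clifford_algebra s B\<^esub> X = clifford_class s B (scale (- 1) p)"
    by (rule minus_equality) (simp_all add: clifford_algebra p rangeI)
  then show "\<ominus>\<^bsub>clifford_algebra s B\<^esub> X \<in> clifford_class s B ` P"
    using assms(3) p by blast
qed (use assms in \<open>auto simp: clifford_algebra intro!: imageI\<close>)

lemma submodule_clifford_classD:
  assumes "submodule N scalar_ring (clifford_algebra s B)"
  shows "N \<subseteq> carrier (clifford_algebra s B)" "clifford_class s B 0 \<in> N"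
    and "clifford_class s B p \<in> N \<Longrightarrow> clifford_class s B q \<in> N \<Longrightarrow> clifford_class s B (p + q) \<in> N"
    and "clifford_class s B p \<in> N \<Longrightarrow> clifford_class s B (scale c p) \<in> N"
proof -
  show "N \<subseteq> carrier (clifford_algebra s B)"
    using module.submoduleE [OF module_clifford_algebra assms] by blast
  show "clifford_class s B 0 \<in> N"
    using subgroup.one_closed [OF submodule.axioms(1) [OF assms]] by (simp add: clifford_algebra)
  show "clifford_class s B (p + q) \<in> N" if "clifford_class s B p \<in> N" "clifford_class s B q \<in> N"
    using module.submoduleE(5) [OF module_clifford_algebra assms that] by (simp add: clifford_algebra)
  show "clifford_class s B (scale c p) \<in> N" if "clifford_class s B p \<in> N"
    using module.submoduleE(4) [OF module_clifford_algebra assms _ that, of c]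
    by (simp add: clifford_algebra scalar_ring_def)
qed

end

end

lemma to_exterior_eq:
  "to_exterior s B X = exterior_class s (symbol B (representative s B X))"
  by (simp add: to_exterior_def symbol_def)

section \<open>Bilinear forms and maps on the Clifford algebra\<close>

locale bilinear_form =
  fixes s :: "'r::comm_ring_1 \<Rightarrow> 'm::ab_group_add \<Rightarrow> 'm" and B :: "'m \<Rightarrow> 'm \<Rightarrow> 'r"
  assumes add_left: "B (x + y) z = B x z + B y z" and add_right: "B x (y + z) = B x y + B x z"
    and scale_left: "B (s c x) y = c * B x y" and scale_right: "B x (s c y) = c * B x y"

lemma bilinear_form_zero: "bilinear_form s (\<lambda>_ _. 0)"
  by standard simp_all

lemma bilinear_form_minus: "bilinear_form s B \<Longrightarrow> bilinear_form s (\<lambda>x y. - B x y)"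
  by (simp add: bilinear_form_def)

text \<open>Contraction with any linear functional descends, whatever the form \<open>B\<close>: on
  the square relation the two terms \<open>E h x\<close> times \<open>x\<close> cancel. The sign in
  front of the relator is its parity, minus for the two linear relations and plus for the quadratic
  one. Leaving \<open>E\<close> independent of \<open>B\<close> allows contraction with coordinates
  of a basis later.\<close>

lemma contract_null:
  assumes "\<And>x y. E h (x + y) = E h x + E h y" "\<And>c x. E h (s c x) = c * E h x"
    and "p \<in> null_ideal s B"
  shows "contract E h p \<in> null_ideal s B"
  using assms(3)
proof (induction rule: null_ideal.induct)
  case (relator r q)
  from relator have "\<exists>r'. relator s B r' \<and> contract E h (r * q) = - (r' * contract E h q) \<or>
    relator s B r' \<and> contract E h (r * q) = r' * contract E h q"
  proof cases
    case (additive x y)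
    have "contract E h (r * q) = - (r * contract E h q)"
      by (simp add: additive assms scale_add_left algebra_simps)
    then show ?thesis using relator by blast
  next
    case (homogeneous c x)
    have "contract E h (r * q) = - (r * contract E h q)"
      by (simp add: homogeneous assms algebra_simps)
    then show ?thesis using relator by blast
  next
    case (square x)
    have "contract E h (word [x] * (word [x] * q)) = word [x] * (word [x] * contract E h q)"
      by (simp add: algebra_simps del: word_mult word_mult')
    then have "contract E h (r * q) = r * contract E h q"
      by (simp add: square algebra_simps)
    then show ?thesis using relator by blast
  qed
  then show ?case
    by (elim exE disjE conjE) (simp_all add: null_ideal_minus null_ideal.relator)
next
  case (left p x)
  then show ?case by (simp add: null_ideal_diff null_ideal_scale null_ideal_left)
next
  case (add p q)
  then show ?case by (simp add: null_ideal_add)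
qed

lemma contract_sum: "contract E h (sum g A) = (\<Sum>a\<in>A. contract E h (g a))"
  by (induction A rule: infinite_finite_induct) simp_all

context bilinear_form
begin

lemma contract_null': "p \<in> null_ideal s B' \<Longrightarrow> contract B h p \<in> null_ideal s B'"
  by (rule contract_null) (simp_all add: add_right scale_right)

text \<open>The operator multiplication by \<open>x\<close> minus \<open>contract B x\<close> has
  the square of multiplication by \<open>x\<close>, minus the scalar \<open>B x x\<close>, because
  \<open>contract B x\<close> squares to zero. Hence the square relation for \<open>B'\<close> turns
  into the one for \<open>B' - B\<close>. The free choice of \<open>B'\<close> makes the statement
  usable in both directions.\<close>

lemma symbol_null:
  "p \<in> null_ideal s B' \<Longrightarrow> symbol B p \<in> null_ideal s (\<lambda>x y. B' x y - B x y)"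
proof (induction rule: null_ideal.induct)
  case (relator r q)
  let ?B = "\<lambda>x y. B' x y - B x y"
  note cadd = contract_form_add [of B, OF add_left]
    and cscale = contract_form_scale [of B "s c x" c x for c x, OF scale_left]
  from relator have "\<exists>r'. relator s ?B r' \<and> symbol B (r * q) = r' * symbol B q"
  proof cases
    case (additive x y)
    have "symbol B (r * q) = r * symbol B q"
      by (simp add: additive cadd algebra_simps)
    then show ?thesis using relator.additive additive by metis
  next
    case (homogeneous c x)
    have "symbol B (r * q) = r * symbol B q"
      by (simp add: homogeneous cscale algebra_simps)
    then show ?thesis using relator.homogeneous homogeneous by metis
  next
    case (square x)
    have "symbol B (word [x] * (word [x] * q)) =
        word [x] * (word [x] * symbol B q) - scale (B x x) (symbol B q)"
      by (simp add: algebra_simps del: word_mult word_mult')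
    then have "symbol B (r * q) = (word [x, x] + scale (?B x x) 1) * symbol B q"
      by (simp add: square scale_diff_left algebra_simps)
    then show ?thesis using relator.square [of s ?B] by blast
  qed
  then show ?case
    by (auto intro: null_ideal.relator)
next
  case (left p x)
  then show ?case by (simp add: null_ideal_diff null_ideal_left contract_null')
next
  case (add p q)
  then show ?case by (simp add: null_ideal_add)
qed

text \<open>One direction takes \<open>B' = B\<close>; the other applies \<open>symbol_null\<close>
  to the form \<open>- B\<close>, starting from the zero form, and cancels the two maps.\<close>

lemma symbol_null_iff: "symbol B p \<in> null_ideal s (\<lambda>_ _. 0) \<longleftrightarrow> p \<in> null_ideal s B"
proof
  assume "symbol B p \<in> null_ideal s (\<lambda>_ _. 0)"
  from bilinear_form.symbol_null [OF bilinear_form_minus [OF bilinear_form_axioms] this]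
  show "p \<in> null_ideal s B"
    by (simp add: symbol_inverse)
next
  assume "p \<in> null_ideal s B"
  then show "symbol B p \<in> null_ideal s (\<lambda>_ _. 0)"
    using symbol_null [of p B] by simp
qed

text \<open>The chosen representative differs from \<open>p\<close> by a null element, which
  \<open>symbol B\<close> sends to a null element of the exterior algebra.\<close>

lemma to_exterior_class: "to_exterior s B (clifford_class s B p) = exterior_class s (symbol B p)"
  by (simp add: to_exterior_eq clifford_class_eq_iff symbol_null_iff representative
      flip: symbol_linear)

lemma anticommutator_null: "word [x, y] + word [y, x] + scale (B x y + B y x) 1 \<in> null_ideal s B"
proof -
  let ?r = "\<lambda>x. word [x, x] + scale (B x x) 1"
  have sum: "word [x + y] - word [x] - word [y] \<in> null_ideal s B"
    by (intro relator_null relator.additive)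
  \<comment> \<open>Polarization of the square relation: the two subtracted products replace the
    letter \<open>x + y\<close> by the sum of letters, first in the left factor and then in the
    right one.\<close>
  have "?r (x + y) - ?r x - ?r y - (word [x + y] - word [x] - word [y]) * word [x + y]
      - (word [x] + word [y]) * (word [x + y] - word [x] - word [y])
      = word [x, y] + word [y, x] + scale (B x y + B y x) 1"
    by (simp add: add_left add_right scale_add_left algebra_simps)
  moreover have "?r z \<in> null_ideal s B" for z
    by (intro relator_null relator.square)
  ultimately show ?thesis
    by (metis sum null_ideal_diff null_ideal_left null_ideal_right)
qed

lemma derivation_null:
  assumes "\<And>x y. D (x + y) = D x + D y" "\<And>c x. D (s c x) = s c (D x)"
    and skew: "\<And>x y. B (D x) y = - B x (D y)"
    and "p \<in> null_ideal s B"
  shows "derivation D p \<in> null_ideal s B"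
  using assms(4)
proof (induction rule: null_ideal.induct)
  case (relator r q)
  from relator have "derivation D r \<in> null_ideal s B"
  proof cases
    case (additive x y)
    then show ?thesis
      by (simp add: assms(1) relator_null relator.additive)
  next
    case (homogeneous c x)
    then show ?thesis
      by (simp add: assms(2) relator_null relator.homogeneous)
  next
    case (square x)
    \<comment> \<open>The derivative of the square relation is the polarized relation for
      \<open>D x\<close> and \<open>x\<close>, whose scalar part vanishes by skewness.\<close>
    have "derivation D (word [x, x] + scale (B x x) 1) = word [D x, x] + word [x, D x]"
      using derivation_word_mult [of D x "word [x]"] by simp
    then show ?thesis
      using anticommutator_null [of "D x" x] by (simp add: square skew)
  qed
  then show ?case
    using relator by (simp add: derivation_mult null_ideal_add null_ideal_right null_ideal.relator)
next
  case (left p x)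
  then show ?case by (simp add: null_ideal_add null_ideal_left)
next
  case (add p q)
  then show ?case by (simp add: null_ideal_add)
qed

end

lemma (in ring_hom1) free_map_null:
  assumes "\<And>x y. f (x + y) = f x + f y" "\<And>c x. f (s c x) = s' (g c) (f x)"
    and "\<And>x. B' (f x) (f x) = g (B x x)" and "p \<in> null_ideal s B"
  shows "free_map g f p \<in> null_ideal s' B'"
  using assms(4)
proof (induction rule: null_ideal.induct)
  case (relator r q)
  from relator have "relator s' B' (free_map g f r)"
    by cases (simp_all add: assms relator.additive relator.homogeneous relator.square
        flip: assms(3))
  then show ?case by (simp add: null_ideal.relator)
qed (simp_all add: null_ideal_left null_ideal_add)

lemma (in ring_hom1) clifford_map_class:
  assumes "\<And>x y. f (x + y) = f x + f y" "\<And>c x. f (s c x) = s' (g c) (f x)"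
    and "\<And>x. B' (f x) (f x) = g (B x x)"
  shows "clifford_map s B s' B' g f (clifford_class s B p) = clifford_class s' B' (free_map g f p)"
  by (simp add: clifford_map_def clifford_class_eq_iff flip: free_map_diff)
    (rule free_map_null [of f s s' B' B, OF assms representative])

section \<open>Bases\<close>

lemma module_ofD:
  assumes "module scalar_ring (module_of s)"
  shows "s (a + b) x = s a x + s b x" "s a (x + y) = s a x + s a y" "s (a * b) x = s a (s b x)"
    "s 1 x = x" "abelian_group (module_of s)"
  using module.smult_l_distr [OF assms] module.smult_r_distr [OF assms]
    module.smult_assoc1 [OF assms] module.smult_one [OF assms] module.axioms(2) [OF assms]
  by (simp_all add: scalar_ring_def module_of_def)

lemma finsum_module_of:
  assumes "module scalar_ring (module_of s)" "finite A"
  shows "finsum (module_of s) f A = sum f A"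
proof -
  interpret abelian_group "module_of s" by (rule module_ofD) fact
  have *: "carrier (module_of s) = UNIV" "add (module_of s) = (+)" "\<zero>\<^bsub>module_of s\<^esub> = 0"
    by (simp_all add: module_of_def)
  show ?thesis
    using assms(2) by induction (simp_all add: *)
qed

definition coordinate ::
  "('r::comm_ring_1 \<Rightarrow> 'm::ab_group_add \<Rightarrow> 'm) \<Rightarrow> 'm set \<Rightarrow> 'm \<Rightarrow> 'm \<Rightarrow> 'r" where
  "coordinate s A b x = (THE c. c \<in> A \<rightarrow>\<^sub>E UNIV \<and> x = (\<Sum>b\<in>A. s (c b) b)) b"

lemma coordinate:
  assumes "module scalar_ring (module_of s)" "finite_basis (module_of s) A"
  shows "x = (\<Sum>b\<in>A. s (coordinate s A b x) b)"
    and "b \<in> A \<Longrightarrow> coordinate s A b (x + y) = coordinate s A b x + coordinate s A b y"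
    and "b \<in> A \<Longrightarrow> coordinate s A b (s c x) = c * coordinate s A b x"
    and "b \<in> A \<Longrightarrow> b' \<in> A \<Longrightarrow> coordinate s A b b' = (if b = b' then 1 else 0)"
proof -
  note s = module_ofD [OF assms(1)]
  have fin: "finite A"
    using assms(2) by (simp add: finite_basis_def)
  have "carrier (module_of s) = UNIV" "smult (module_of s) = s"
    by (simp_all add: module_of_def)
  then have unique: "\<exists>!c. c \<in> A \<rightarrow>\<^sub>E UNIV \<and> x = (\<Sum>b\<in>A. s (c b) b)" for x
    using assms(2) by (simp add: finite_basis_def finsum_module_of [OF assms(1) fin])
  let ?f = "coordinate s A"
  show x: "x = (\<Sum>b\<in>A. s (?f b x) b)" for x
    using theI' [OF unique [of x]] by (simp add: coordinate_def)
  have eq: "?f b x = c b" if "x = (\<Sum>b\<in>A. s (c b) b)" "b \<in> A" for x b c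
  proof -
    \<comment> \<open>Uniqueness holds among extensional families, so an arbitrary family of
      coefficients is first cut down to \<open>A\<close>.\<close>
    have "(THE c. c \<in> A \<rightarrow>\<^sub>E UNIV \<and> x = (\<Sum>b\<in>A. s (c b) b)) = restrict c A"
      by (rule the1_equality [OF unique]) (simp add: that(1))
    then show ?thesis using that(2) by (simp add: coordinate_def)
  qed
  have s0: "s 0 y = 0" for y
    using s(1) [of 0 0] by simp
  have ssum: "s c (sum h A) = (\<Sum>b\<in>A. s c (h b))" for c h
    using fin s(2) [of _ 0 0] by (induction A) (simp_all add: s(2))
  show "?f b (x + y) = ?f b x + ?f b y" if "b \<in> A"
    by (rule eq [where c = "\<lambda>b. ?f b x + ?f b y"])
      (simp_all add: s(1) sum.distrib that flip: x [of x] x [of y])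
  show "?f b (s c x) = c * ?f b x" if "b \<in> A"
    by (rule eq [where c = "\<lambda>b. c * ?f b x"]) (simp_all add: s(3) that flip: x [of x] ssum)
  show "?f b b' = (if b = b' then 1 else 0)" if "b \<in> A" "b' \<in> A"
  proof (rule eq [where c = "\<lambda>b. if b = b' then 1 else 0"])
    have "(\<Sum>b\<in>A. s (if b = b' then 1 else 0) b) = (\<Sum>b\<in>A. if b = b' then b else 0)"
      by (intro sum.cong) (simp_all add: s s0)
    then show "b' = (\<Sum>b\<in>A. s (if b = b' then 1 else 0) b)"
      using fin that(2) by simp
  qed (fact that)
qed

text \<open>The full preimage of a span of classes of words: taking in the null ideal makes
  membership depend on the class alone.\<close>

inductive_set word_span ::
  "('r::comm_ring_1 \<Rightarrow> 'm \<Rightarrow> 'm::ab_group_add) \<Rightarrow> ('m \<Rightarrow> 'm \<Rightarrow> 'r) \<Rightarrow> 'm list set \<Rightarrow>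
   ('m list \<Rightarrow>\<^sub>0 'r) set"
  for s B A where
  null: "p \<in> null_ideal s B \<Longrightarrow> p \<in> word_span s B A"
| word: "w \<in> A \<Longrightarrow> word w \<in> word_span s B A"
| add: "p \<in> word_span s B A \<Longrightarrow> q \<in> word_span s B A \<Longrightarrow> p + q \<in> word_span s B A"
| scale: "p \<in> word_span s B A \<Longrightarrow> scale c p \<in> word_span s B A"

lemma word_span_minus: "p \<in> word_span s B A \<Longrightarrow> - p \<in> word_span s B A"
  using word_span.scale [of p s B A "- 1"] by simp

lemma word_span_diff:
  "p \<in> word_span s B A \<Longrightarrow> q \<in> word_span s B A \<Longrightarrow> p - q \<in> word_span s B A"
  using word_span.add [of p s B A "- q"] word_span_minus [of q s B A] by simp

lemma word_span_sum:
  "(\<And>x. x \<in> X \<Longrightarrow> f x \<in> word_span s B A) \<Longrightarrow> sum f X \<in> word_span s B A"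
  by (induction X rule: infinite_finite_induct)
    (simp_all add: word_span.add word_span.null)

lemma word_span_cong: "p - q \<in> null_ideal s B \<Longrightarrow> q \<in> word_span s B A \<Longrightarrow> p \<in> word_span s B A"
  using word_span.add [OF word_span.null, of "p - q" s B q A] by simp

lemma word_span_mono: "p \<in> word_span s B A \<Longrightarrow> A \<subseteq> A' \<Longrightarrow> p \<in> word_span s B A'"
  by (induction rule: word_span.induct) (auto intro: word_span.intros)

lemma word_span_mult:
  assumes "p \<in> word_span s B A" "\<And>w. w \<in> A \<Longrightarrow> q * word w \<in> word_span s B A'"
  shows "q * p \<in> word_span s B A'"
  using assms
  by (induction rule: word_span.induct)
    (simp_all add: distrib_left word_span.intros null_ideal_left del: word_mult)

lemma word_span_combination:
  assumes "p \<in> word_span s B A" "finite A"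
  shows "\<exists>c. p - (\<Sum>w\<in>A. scale (c w) (word w)) \<in> null_ideal s B"
  using assms(1)
proof (induction rule: word_span.induct)
  case (null p)
  then show ?case by (intro exI [of _ "\<lambda>_. 0"]) simp
next
  case (word w)
  have "(\<Sum>v\<in>A. scale (if v = w then 1 else 0) (word v)) =
      (\<Sum>v\<in>A. if v = w then word v else (0 :: 'a list \<Rightarrow>\<^sub>0 'b))"
    by (intro sum.cong) simp_all
  then show ?case
    using assms(2) word by (intro exI [of _ "\<lambda>v. if v = w then 1 else 0"]) simp
next
  case (add p q)
  then obtain c d where "p - (\<Sum>w\<in>A. scale (c w) (word w)) \<in> null_ideal s B"
    "q - (\<Sum>w\<in>A. scale (d w) (word w)) \<in> null_ideal s B" by blast
  from null_ideal_add [OF this] show ?case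
    by (intro exI [of _ "\<lambda>w. c w + d w"]) (simp add: scale_add_left sum.distrib algebra_simps)
next
  case (scale p k)
  then obtain c where "p - (\<Sum>w\<in>A. scale (c w) (word w)) \<in> null_ideal s B" by blast
  from null_ideal_scale [OF this, of k] show ?case
    by (intro exI [of _ "\<lambda>w. k * c w"]) (simp add: scale_sum)
qed

lemma word_zero_null: "word [0] \<in> null_ideal s B"
  using null_ideal_minus [OF relator_null [OF relator.additive [where x = 0 and y = 0]]] by simp

lemma word_sum_null:
  "word [(\<Sum>b\<in>A. s (c b) b)] - (\<Sum>b\<in>A. scale (c b) (word [b])) \<in> null_ideal s B"
proof (induction A rule: infinite_finite_induct)
  case (insert x F)
  let ?y = "\<Sum>b\<in>F. s (c b) b"
  have "(word [s (c x) x + ?y] - word [s (c x) x] - word [?y]) +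
      (word [s (c x) x] - scale (c x) (word [x])) +
      (word [?y] - (\<Sum>b\<in>F. scale (c b) (word [b]))) \<in> null_ideal s B"
    by (intro null_ideal_add relator_null relator.additive relator.homogeneous insert.IH)
  then show ?case using insert.hyps by (simp add: algebra_simps)
qed (simp_all add: word_zero_null)

section \<open>Ordered monomials in a basis: spanning and independence\<close>

lemma set_subseqs_Cons: "set (subseqs (b # bs)) = (#) b ` set (subseqs bs) \<union> set (subseqs bs)"
  by (simp add: Let_def)

lemma Nil_in_subseqs: "[] \<in> set (subseqs bs)"
  by (induction bs) (simp_all add: Let_def)

lemma set_subset_of_subseqs:
  assumes "w \<in> set (subseqs bs)" shows "set w \<subseteq> set bs"
  using imageI [OF assms, of set] by (simp add: subseqs_powset)

context bilinear_form
begin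

text \<open>Reordering: a letter is moved into its place by anticommuting it past the first letter.\<close>

lemma word_span_subseqs_mult:
  "b \<in> set bs \<Longrightarrow> p \<in> word_span s B (set (subseqs bs)) \<Longrightarrow>
    word [b] * p \<in> word_span s B (set (subseqs bs))"
proof (induction bs arbitrary: b p)
  case (Cons a bs)
  let ?S = "word_span s B (set (subseqs bs))" and ?S' = "word_span s B (set (subseqs (a # bs)))"
  have sub: "p \<in> ?S'" if "p \<in> ?S" for p
    using that by (rule word_span_mono) (simp add: set_subseqs_Cons del: subseqs.simps)
  have a: "word [a] * p \<in> ?S'" if "p \<in> ?S" for p
    using that by (rule word_span_mult)
      (auto simp: set_subseqs_Cons intro: word_span.word simp del: subseqs.simps)
  show ?case
  proof (rule word_span_mult [OF Cons.prems(2)])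
    fix w assume "w \<in> set (subseqs (a # bs))"
    then consider u where "w = a # u" "u \<in> set (subseqs bs)" | "w \<in> set (subseqs bs)"
      by (auto simp: set_subseqs_Cons simp del: subseqs.simps)
    then show "word [b] * word w \<in> ?S'"
    proof cases
      case 1
      have u: "word u \<in> ?S" by (simp add: 1 word_span.word)
      show ?thesis
      proof (cases "b = a")
        case True
        have "(word [a, a] + scale (B a a) 1) * word u \<in> null_ideal s B"
          by (intro null_ideal.relator relator.square)
        then have "word [b] * word w - - scale (B a a) (word u) \<in> null_ideal s B"
          by (simp add: 1 True distrib_right)
        then show ?thesis
          by (rule word_span_cong) (intro word_span_minus word_span.scale sub u)
      next
        case False
        with Cons.prems have "b \<in> set bs" by simp
        from a [OF Cons.IH [OF this u]] sub [OF u]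
        have *: "- (word [a] * (word [b] * word u)) - scale (B b a + B a b) (word u) \<in> ?S'"
          by (intro word_span_diff word_span_minus word_span.scale)
        have "(word [b, a] + word [a, b] + scale (B b a + B a b) 1) * word u
            \<in> null_ideal s B"
          by (intro null_ideal_right anticommutator_null)
        then have "word [b] * word w - (- (word [a] * (word [b] * word u))
            - scale (B b a + B a b) (word u)) \<in> null_ideal s B"
          by (simp add: 1 algebra_simps)
        then show ?thesis
          by (rule word_span_cong) (rule *)
      qed
    next
      case 2
      have u: "word w \<in> ?S" by (simp add: 2 word_span.word)
      show ?thesis
      proof (cases "b = a")
        case True
        then show ?thesis using a [OF u] by metis
      next
        case False
        with Cons.prems have "b \<in> set bs" by simp
        from sub [OF Cons.IH [OF this u]] show ?thesis .
      qed
    qed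
  qed
qed simp

lemma word_span_subseqs_basis:
  assumes "\<And>x. x = (\<Sum>b\<in>set bs. s (f b x) b)"
  shows "p \<in> word_span s B (set (subseqs bs))"
proof (induction p rule: free_algebra_induct)
  case one
  show ?case
    using word_span.word [OF Nil_in_subseqs] by simp
next
  case (word x p)
  have "(word [x] - (\<Sum>b\<in>set bs. scale (f b x) (word [b]))) * p \<in> null_ideal s B"
    using word_sum_null [where c = "\<lambda>b. f b x" and A = "set bs" and s = s and B = B]
    by (simp add: null_ideal_right flip: assms)
  moreover have "(\<Sum>b\<in>set bs. scale (f b x) (word [b])) * p \<in> word_span s B (set (subseqs bs))"
    using word by (simp add: sum_distrib_right word_span_sum word_span.scale word_span_subseqs_mult)
  ultimately show ?case
    by (intro word_span_cong [of "word [x] * p"]) (simp_all add: left_diff_distrib)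
qed (simp_all add: word_span.intros)

text \<open>Clifford relations have constant terms, so the constant coefficient is not well defined
  on the quotient. The symbol map fixes \<open>scale c 1\<close> and moves the question to the zero
  form, whose relations have no constant term.\<close>

lemma scale_one_null:
  assumes "scale c 1 \<in> null_ideal s B"
  shows "c = 0"
proof -
  define \<epsilon> :: "('m list \<Rightarrow>\<^sub>0 'r) \<Rightarrow> ('m list \<Rightarrow>\<^sub>0 'r)"
    where "\<epsilon> = linear_extension (\<lambda>w. if w = [] then 1 else 0)"
  have word: "\<epsilon> (word [x] * p) = 0" for x p
    by (induction p rule: scale_induct_word) (simp_all add: \<epsilon>_def distrib_left)
  have lin: "\<epsilon> (p + q) = \<epsilon> p + \<epsilon> q" "\<epsilon> (p - q) = \<epsilon> p - \<epsilon> q" "\<epsilon> (scale c p) = scale c (\<epsilon> p)" for p q c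
    by (simp_all add: \<epsilon>_def)
  have \<epsilon>: "\<epsilon> p = 0" if "p \<in> null_ideal s (\<lambda>_ _. 0)" for p
    using that
  proof (induction rule: null_ideal.induct)
    case (relator r q)
    then show ?case
    proof cases
      case (square x)
      then show ?thesis using word [of x "word [x] * q"] by simp
    qed (simp_all add: left_diff_distrib lin word)
  qed (simp_all add: lin word)
  have "scale c 1 \<in> null_ideal s (\<lambda>_ _. 0)"
    using assms symbol_null_iff [of "scale c 1"] by simp
  then have "scale c 1 = (0 :: 'm list \<Rightarrow>\<^sub>0 'r)"
    using \<epsilon> [of "scale c 1"] by (simp add: \<epsilon>_def)
  then have "Poly_Mapping.lookup (Poly_Mapping.single [] c) ([] :: 'm list) = 0"
    by (simp add: scale_def)
  then show ?thesis by simp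
qed

text \<open>Contraction with the coordinate of the first basis vector \<open>b\<close> isolates the words that
  contain \<open>b\<close>.\<close>

lemma subseqs_independent:
  assumes "distinct bs"
    and "\<And>b x y. b \<in> set bs \<Longrightarrow> f b (x + y) = f b x + f b y"
    and "\<And>b c x. b \<in> set bs \<Longrightarrow> f b (s c x) = c * f b x"
    and "\<And>b b'. b \<in> set bs \<Longrightarrow> b' \<in> set bs \<Longrightarrow> f b b' = (if b = b' then 1 else 0)"
    and "(\<Sum>w\<in>set (subseqs bs). scale (c w) (word w)) \<in> null_ideal s B"
    and "w \<in> set (subseqs bs)"
  shows "c w = 0"
  using assms
proof (induction bs arbitrary: c w)
  case Nil
  then show ?case using scale_one_null by simp
next
  case (Cons b bs)
  \<comment> \<open>\<open>?E\<close> ignores its first argument, so that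
    \<open>contract ?E 0\<close> is contraction with the functional \<open>f b\<close>; the
    \<open>0\<close> is a dummy.\<close>
  let ?S = "set (subseqs bs)" and ?E = "\<lambda>_ :: 'm. f b"
  define p where "p = (\<Sum>w\<in>?S. scale (c w) (word w))"
  define q where "q = (\<Sum>w\<in>?S. scale (c (b # w)) (word w))"
  have disj: "(#) b ` ?S \<inter> ?S = {}"
    using set_subset_of_subseqs Cons.prems(1) by fastforce
  have null: "word [b] * q + p \<in> null_ideal s B"
    using Cons.prems(5) unfolding set_subseqs_Cons
    by (subst (asm) sum.union_disjoint [OF _ _ disj])
      (simp_all add: sum.reindex p_def q_def sum_distrib_left)
  have "contract ?E 0 (word w) = 0" if "set w \<subseteq> set bs" for w
    using that Cons.prems(1,4)
  proof (induction w)
    case (Cons x w)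
    then show ?case
      using contract_word_mult [of ?E 0 x "word w"] by (auto simp del: contract_word_mult)
  qed simp
  then have "contract ?E 0 p = 0" "contract ?E 0 q = 0"
    by (simp_all add: p_def q_def contract_sum set_subset_of_subseqs)
  then have "contract ?E 0 (word [b] * q + p) = q"
    using Cons.prems(4) by simp
  then have "q \<in> null_ideal s B"
    using contract_null [of ?E 0 s _ B, OF _ _ null] Cons.prems(2,3) by simp
  moreover from this have "p \<in> null_ideal s B"
    using null_ideal_diff [OF null null_ideal_left [of q s B "word [b]"]] by simp
  ultimately show ?case
    using Cons.IH [of c] Cons.IH [of "\<lambda>w. c (b # w)"] Cons.prems(1-4,6)
    by (auto simp: p_def q_def set_subseqs_Cons simp del: subseqs.simps)
qed

lemma finsum_clifford_class:
  "finite A \<Longrightarrow> finsum (clifford_algebra s B) (\<lambda>a. clifford_class s B (g a)) A =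
    clifford_class s B (sum g A)"
proof -
  interpret ring "clifford_algebra s B" by (rule clifford_algebra)
  show "finite A \<Longrightarrow> ?thesis"
    by (induction A rule: finite_induct) (simp_all add: clifford_algebra Pi_iff rangeI)
qed

text \<open>Valid over any commutative coefficient ring, so that one argument supplies bases of the
  integral and of the complex algebra, both indexed by subsequences.\<close>

lemma clifford_basis:
  assumes "module scalar_ring (module_of s)" "finite_basis (module_of s) (set bs)" "distinct bs"
  defines "\<beta> \<equiv> \<lambda>w. clifford_class s B (word w)"
  shows "inj_on \<beta> (set (subseqs bs))"
    and "finite_basis (clifford_algebra s B) (\<beta> ` set (subseqs bs))"
proof -
  let ?S = "set (subseqs bs)"
  note f = coordinate [OF assms(1,2)]
  note indep = subseqs_independent [OF assms(3), of "coordinate s (set bs)", OF f(2-4)]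
  show inj: "inj_on \<beta> ?S"
  proof
    fix v w assume vw: "v \<in> ?S" "w \<in> ?S" "\<beta> v = \<beta> w"
    \<comment> \<open>The difference of two indicator functions. For \<open>v \<noteq> w\<close> its
      value at \<open>v\<close> would be 1, against independence.\<close>
    let ?c = "\<lambda>u. (if u = v then 1 else 0) - (if u = w then 1 else 0) :: 'r"
    have "(\<Sum>u\<in>?S. scale (?c u) (word u)) =
        (\<Sum>u\<in>?S. if u = v then word u else (0 :: 'm list \<Rightarrow>\<^sub>0 'r)) - (\<Sum>u\<in>?S. if u = w then word u else 0)"
      by (subst sum_subtractf [symmetric]) (intro sum.cong, simp_all)
    also have "\<dots> \<in> null_ideal s B"
      using vw by (simp add: \<beta>_def clifford_class_eq_iff)
    finally show "v = w"
      using indep [of ?c v] vw(1) by (simp split: if_splits)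
  qed
  \<comment> \<open>A basis is a set of classes, while the computation is indexed by words;
    \<open>r\<close> recovers the word from its class.\<close>
  define r where "r = inv_into ?S \<beta>"
  have sum: "(\<Oplus>\<^bsub>clifford_algebra s B\<^esub>b\<in>\<beta> ` ?S. c b \<odot>\<^bsub>clifford_algebra s B\<^esub> b) =
      clifford_class s B (\<Sum>w\<in>?S. scale (c (\<beta> w)) (word w))" for c
  proof -
    interpret ring "clifford_algebra s B" by (rule clifford_algebra)
    have b: "clifford_class s B (scale (c b) (word (r b))) = c b \<odot>\<^bsub>clifford_algebra s B\<^esub> b"
      if "b \<in> \<beta> ` ?S" for b
      using f_inv_into_f [OF that] by (simp add: r_def \<beta>_def flip: clifford_algebra(7))
    have "(\<Oplus>\<^bsub>clifford_algebra s B\<^esub>b\<in>\<beta> ` ?S. c b \<odot>\<^bsub>clifford_algebra s B\<^esub> b) =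
        (\<Oplus>\<^bsub>clifford_algebra s B\<^esub>b\<in>\<beta> ` ?S. clifford_class s B (scale (c b) (word (r b))))"
      using b by (intro finsum_cong') (auto simp: clifford_algebra)
    also have "\<dots> = clifford_class s B (\<Sum>b\<in>\<beta> ` ?S. scale (c b) (word (r b)))"
      by (rule finsum_clifford_class) simp
    also have "(\<Sum>b\<in>\<beta> ` ?S. scale (c b) (word (r b))) = (\<Sum>w\<in>?S. scale (c (\<beta> w)) (word w))"
      using inj by (simp add: sum.reindex r_def)
    finally show ?thesis .
  qed
  show "finite_basis (clifford_algebra s B) (\<beta> ` ?S)"
    unfolding finite_basis_def
  proof (intro conjI ballI)
    fix X assume "X \<in> carrier (clifford_algebra s B)"
    then obtain p where p: "X = clifford_class s B p"
      by (rule clifford_class_cases)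
    obtain c where c: "p - (\<Sum>w\<in>?S. scale (c w) (word w)) \<in> null_ideal s B"
      using word_span_combination [OF word_span_subseqs_basis [OF f(1)]] by blast
    show "\<exists>!c. c \<in> \<beta> ` ?S \<rightarrow>\<^sub>E UNIV \<and>
      X = (\<Oplus>\<^bsub>clifford_algebra s B\<^esub>b\<in>\<beta> ` ?S. c b \<odot>\<^bsub>clifford_algebra s B\<^esub> b)"
    proof (rule ex_ex1I)
      have "(\<Sum>w\<in>?S. scale (restrict (c \<circ> r) (\<beta> ` ?S) (\<beta> w)) (word w)) =
          (\<Sum>w\<in>?S. scale (c w) (word w))"
        using inj by (intro sum.cong) (simp_all add: r_def)
      then show "\<exists>c. c \<in> \<beta> ` ?S \<rightarrow>\<^sub>E UNIV \<and>
        X = (\<Oplus>\<^bsub>clifford_algebra s B\<^esub>b\<in>\<beta> ` ?S. c b \<odot>\<^bsub>clifford_algebra s B\<^esub> b)"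
        using c unfolding sum
        by (intro exI [of _ "restrict (c \<circ> r) (\<beta> ` ?S)"]) (simp add: p clifford_class_eq_iff)
    next
      fix c d
      assume "c \<in> \<beta> ` ?S \<rightarrow>\<^sub>E UNIV \<and>
          X = (\<Oplus>\<^bsub>clifford_algebra s B\<^esub>b\<in>\<beta> ` ?S. c b \<odot>\<^bsub>clifford_algebra s B\<^esub> b)"
        and "d \<in> \<beta> ` ?S \<rightarrow>\<^sub>E UNIV \<and>
          X = (\<Oplus>\<^bsub>clifford_algebra s B\<^esub>b\<in>\<beta> ` ?S. d b \<odot>\<^bsub>clifford_algebra s B\<^esub> b)"
      then have cd: "c \<in> \<beta> ` ?S \<rightarrow>\<^sub>E UNIV" "d \<in> \<beta> ` ?S \<rightarrow>\<^sub>E UNIV"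
        and "(\<Sum>w\<in>?S. scale (c (\<beta> w) - d (\<beta> w)) (word w)) \<in> null_ideal s B"
        by (auto simp: sum clifford_class_eq_iff scale_diff_left sum_subtractf
            dest: null_ideal_minus)
      then have "c (\<beta> w) = d (\<beta> w)" if "w \<in> ?S" for w
        using indep [of "\<lambda>w. c (\<beta> w) - d (\<beta> w)" w] that by simp
      then show "c = d"
        using cd by (intro PiE_ext) auto
    qed
  qed (auto simp: \<beta>_def clifford_algebra)
qed

end

section \<open>The grading of the exterior and Clifford algebras\<close>

lemma word_span_subset_submodule:
  assumes N: "submodule N scalar_ring (clifford_algebra s B)"
    and words: "\<And>w. w \<in> A \<Longrightarrow> clifford_class s B (word w) \<in> N"
    and "p \<in> word_span s B A"
  shows "clifford_class s B p \<in> N"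
  using assms(3)
proof (induction rule: word_span.induct)
  case (null p)
  then have "clifford_class s B p = clifford_class s B 0"
    by (simp add: clifford_class_eq_iff)
  then show ?case using submodule_clifford_classD(2) [OF N] by simp
next
  case (word w)
  then show ?case by (rule words)
next
  case (add p q)
  then show ?case by (intro submodule_clifford_classD(3) [OF N])
next
  case (scale p c)
  then show ?case by (intro submodule_clifford_classD(4) [OF N])
qed

lemma submodule_word_span:
  "submodule (clifford_class s B ` word_span s B A) scalar_ring (clifford_algebra s B)"
  by (rule submodule_clifford_class) (simp_all add: word_span.intros)

lemma span_of_eqI:
  assumes "submodule N scalar_ring M" "X \<subseteq> N"
    and "\<And>N'. submodule N' scalar_ring M \<Longrightarrow> X \<subseteq> N' \<Longrightarrow> N \<subseteq> N'"
  shows "span_of M X = N"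
  unfolding span_of_def
proof (rule antisym)
  show "\<Inter> {N. submodule N scalar_ring M \<and> X \<subseteq> N} \<subseteq> N"
    by (rule Inter_lower) (simp add: assms)
  show "N \<subseteq> \<Inter> {N. submodule N scalar_ring M \<and> X \<subseteq> N}"
    by (rule Inter_greatest) (simp add: assms)
qed

lemma span_of_words:
  "span_of (clifford_algebra s B) ((\<lambda>w. clifford_class s B (word w)) ` A) =
    clifford_class s B ` word_span s B A"
proof (rule span_of_eqI [OF submodule_word_span])
  show "(\<lambda>w. clifford_class s B (word w)) ` A \<subseteq> clifford_class s B ` word_span s B A"
    by (simp add: image_subset_iff word_span.word)
  fix N assume N: "submodule N scalar_ring (clifford_algebra s B)"
    "(\<lambda>w. clifford_class s B (word w)) ` A \<subseteq> N"
  then show "clifford_class s B ` word_span s B A \<subseteq> N"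
    using word_span_subset_submodule [OF N(1), of A] by (simp add: image_subset_iff)
qed

text \<open>A part of \<open>exterior_hodge\<close> is a span of a union of spans; only the words
  generating the inner spans matter.\<close>

lemma span_of_UN_word_span:
  "span_of (clifford_algebra s B) (\<Union>A\<in>\<A>. clifford_class s B ` word_span s B A) =
    clifford_class s B ` word_span s B (\<Union>\<A>)"
proof (rule span_of_eqI [OF submodule_word_span])
  show "(\<Union>A\<in>\<A>. clifford_class s B ` word_span s B A) \<subseteq> clifford_class s B ` word_span s B (\<Union>\<A>)"
    by (intro UN_least image_mono subsetI) (erule word_span_mono, erule Union_upper)
  fix N assume N: "submodule N scalar_ring (clifford_algebra s B)"
    "(\<Union>A\<in>\<A>. clifford_class s B ` word_span s B A) \<subseteq> N"
  have "clifford_class s B (word w) \<in> N" if "w \<in> \<Union>\<A>" for w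
  proof -
    from that obtain A where "A \<in> \<A>" "w \<in> A" by (rule UnionE)
    then show ?thesis
      by (intro subsetD [OF N(2)] UN_I imageI word_span.word)
  qed
  then show "clifford_class s B ` word_span s B (\<Union>\<A>) \<subseteq> N"
    by (intro image_subsetI) (rule word_span_subset_submodule [OF N(1)])
qed

lemma listset_replicate: "listset (replicate n A) = {xs. length xs = n \<and> set xs \<subseteq> A}"
  by (induction n) (auto simp: set_Cons_def length_Suc_conv)

lemma word_span_Un:
  "p \<in> word_span s B (A \<union> A') \<Longrightarrow> \<exists>q\<in>word_span s B A. \<exists>r\<in>word_span s B A'. p = q + r"
proof (induction rule: word_span.induct)
  case (null p)
  then show ?case
    by (intro bexI [of _ p] bexI [of _ 0]) (simp_all add: word_span.null)
next
  case (word w)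
  then show ?case
  proof
    assume "w \<in> A"
    then show ?thesis
      by (intro bexI [of _ "word w"] bexI [of _ 0]) (simp_all add: word_span.intros)
  next
    assume "w \<in> A'"
    then show ?thesis
      by (intro bexI [of _ 0] bexI [of _ "word w"]) (simp_all add: word_span.intros)
  qed
next
  case (add p q)
  then obtain p1 p2 q1 q2 where "p1 \<in> word_span s B A" "q1 \<in> word_span s B A"
    "p2 \<in> word_span s B A'" "q2 \<in> word_span s B A'" "p = p1 + p2" "q = q1 + q2" by blast
  then show ?case
    by (intro bexI [of _ "p1 + q1"] bexI [of _ "p2 + q2"]) (simp_all add: word_span.add)
next
  case (scale p c)
  then obtain p1 p2 where "p1 \<in> word_span s B A" "p2 \<in> word_span s B A'" "p = p1 + p2" by blast
  then show ?case
    by (intro bexI [of _ "scale c p1"] bexI [of _ "scale c p2"]) (simp_all add: word_span.scale)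
qed

lemma scale_null_cancel:
  fixes c :: "'r::field"
  assumes "scale c p \<in> null_ideal s B" "c \<noteq> 0"
  shows "p \<in> null_ideal s B"
  using null_ideal_scale [OF assms(1), of "inverse c"] assms(2) by simp

text \<open>In the free algebra the letters \<open>- x\<close> and \<open>x\<close> are unrelated
  generators; the sign can be taken out only modulo the relations.\<close>

lemma word_minus_null: "word [- x] + word [x] \<in> null_ideal s B"
proof -
  have "word [- x + x] - word [- x] - word [x] \<in> null_ideal s B"
    by (intro relator_null relator.additive)
  from null_ideal_diff [OF word_zero_null this] show ?thesis
    by (simp add: add.commute)
qed

text \<open>What the algebra needs from the Hodge structure, separated from lattice and conjugation.
  The vectors \<open>\<sigma>\<close> and \<open>\<tau>\<close> record that the two outer parts lie
  on lines, which makes two factors of the same outer type wedge to zero.\<close>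

locale hodge_grading = bilinear_form s B
  for s :: "complex \<Rightarrow> 'v::ab_group_add \<Rightarrow> 'v" and B +
  fixes F :: "int \<Rightarrow> int \<Rightarrow> 'v set" and D :: "'v \<Rightarrow> 'v" and \<sigma> \<tau> :: 'v
  assumes D_add: "D (x + y) = D x + D y" and D_scale: "D (s c x) = s c (D x)"
    and D_skew: "B (D x) y = - B x (D y)"
    and D_20: "x \<in> F 2 0 \<Longrightarrow> D x = x" and D_11: "x \<in> F 1 1 \<Longrightarrow> D x = 0"
    and D_02: "x \<in> F 0 2 \<Longrightarrow> D x = - x"
    and sum_F: "\<exists>a\<in>F 2 0. \<exists>b\<in>F 1 1. \<exists>c\<in>F 0 2. x = a + b + c"
    and F_20: "F 2 0 \<subseteq> range (\<lambda>c. s c \<sigma>)" and F_02: "F 0 2 \<subseteq> range (\<lambda>c. s c \<tau>)"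
begin

abbreviation "N \<equiv> null_ideal s (\<lambda>_ _. 0)"

definition "W20 = {a # xs | a xs. a \<in> F 2 0 \<and> set xs \<subseteq> F 1 1}"
definition "W02 = {c # xs | c xs. c \<in> F 0 2 \<and> set xs \<subseteq> F 1 1}"
text \<open>The empty word belongs to the first set, which gives the unit the type (1, 1).\<close>

definition "W11 = {xs. set xs \<subseteq> F 1 1} \<union>
  {a # c # xs | a c xs. a \<in> F 2 0 \<and> c \<in> F 0 2 \<and> set xs \<subseteq> F 1 1}"

text \<open>For \<open>k \<ge> 1\<close> the truncated subtraction is exact, so the union over
  \<open>k\<close> only forgets the length of the tail.\<close>

lemma UN_listset_Cons:
  "(\<Union>k\<in>{1..}. listset (A # replicate (k - 1) A')) = {a # xs | a xs. a \<in> A \<and> set xs \<subseteq> A'}"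
proof -
  have "\<exists>k\<ge>1. length xs = k - 1" for xs :: "'a list"
    by (rule exI [of _ "Suc (length xs)"]) simp
  then show ?thesis
    by (auto simp: listset_replicate set_Cons_def)
qed

lemma UN_listset_Cons_Cons:
  "(\<Union>k\<in>{2..}. listset (A # A' # replicate (k - 2) A'')) =
    {a # b # xs | a b xs. a \<in> A \<and> b \<in> A' \<and> set xs \<subseteq> A''}"
proof -
  have "\<exists>k\<ge>2. length xs = k - 2" for xs :: "'a list"
    by (rule exI [of _ "length xs + 2"]) simp
  then show ?thesis
    by (auto simp: listset_replicate set_Cons_def) blast
qed

lemma UN_wedge: "(\<Union>k\<in>K. wedge s (Ws k)) =
  (\<Union>A\<in>(\<lambda>k. listset (Ws k)) ` K. exterior_class s ` word_span s (\<lambda>_ _. 0) A)"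
  by (simp add: wedge_def span_of_words)

lemma exterior_hodge_20: "exterior_hodge s F 2 0 = exterior_class s ` word_span s (\<lambda>_ _. 0) W20"
  by (simp only: exterior_hodge_def UN_wedge span_of_UN_word_span UN_listset_Cons W20_def if_True
      simp_thms)

lemma exterior_hodge_02: "exterior_hodge s F 0 2 = exterior_class s ` word_span s (\<lambda>_ _. 0) W02"
  unfolding exterior_hodge_def UN_wedge span_of_UN_word_span UN_listset_Cons W02_def
  by simp

lemma exterior_hodge_11: "exterior_hodge s F 1 1 = exterior_class s ` word_span s (\<lambda>_ _. 0) W11"
proof -
  have "(\<Union>k. listset (replicate k (F 1 1))) = {xs. set xs \<subseteq> F 1 1}"
    by (auto simp: listset_replicate)
  then have "\<Union>(range (\<lambda>k. listset (replicate k (F 1 1))) \<union>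
      (\<lambda>k. listset (F 2 0 # F 0 2 # replicate (k - 2) (F 1 1))) ` {2..}) = W11"
    unfolding Union_Un_distrib UN_listset_Cons_Cons W11_def by simp
  then show ?thesis
    unfolding exterior_hodge_def UN_wedge UN_Un [symmetric] span_of_UN_word_span
    by simp
qed

text \<open>\<open>word_span\<close> is saturated under the relations, so no change of
  representative is lost.\<close>

lemma exterior_class_iff:
  "exterior_class s p \<in> exterior_class s ` word_span s (\<lambda>_ _. 0) A \<longleftrightarrow>
    p \<in> word_span s (\<lambda>_ _. 0) A"
  by (auto simp: clifford_class_eq_iff intro: word_span_cong)

subsection \<open>The exterior algebra is the sum of its three parts\<close>

lemma anticommute: "word (x # y # w) + word (y # x # w) \<in> N"
proof -
  have "(word [x, y] + word [y, x] + scale (0 + 0) 1) * word w \<in> N"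
    by (intro null_ideal_right bilinear_form.anticommutator_null bilinear_form_zero)
  then show ?thesis by (simp add: distrib_right)
qed

lemma repeated:
  assumes "x \<in> range (\<lambda>c. s c z)" "y \<in> range (\<lambda>c. s c z)"
  shows "word (x # y # w) \<in> N"
proof -
  obtain c d where xy: "x = s c z" "y = s d z" using assms by auto
  have h: "word [s c z] - scale c (word [z]) \<in> N" for c
    by (intro relator_null relator.homogeneous)
  have "(word [z, z] + scale 0 1) * scale (c * d) (word w) \<in> N"
    by (intro null_ideal.relator relator.square)
  moreover have "(word [x] - scale c (word [z])) * (word [y] * word w) \<in> N"
    unfolding xy by (intro null_ideal_right h)
  moreover have "scale c (word [z]) * ((word [y] - scale d (word [z])) * word w) \<in> N"
    unfolding xy by (intro null_ideal_left null_ideal_right h)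
  \<comment> \<open>The sum telescopes to \<open>word (x # y # w)\<close>: \<open>x\<close> is
    replaced by \<open>scale c (word [z])\<close>, then \<open>y\<close> by
    \<open>scale d (word [z])\<close>, and the square relation of \<open>z\<close> kills what
    remains.\<close>
  ultimately have "(word [z, z] + scale 0 1) * scale (c * d) (word w) +
      (word [x] - scale c (word [z])) * (word [y] * word w) +
      scale c (word [z]) * ((word [y] - scale d (word [z])) * word w) \<in> N"
    by (intro null_ideal_add)
  then show ?thesis
    by (simp add: algebra_simps)
qed

text \<open>A new letter is brought to its place by transpositions: type (1, 1) moves into the tail
  and type (0, 2) behind an existing letter of type (2, 0). If a letter of the same outer type is
  already present, the two meet and the word is null.\<close>

lemma word_span_W_mult:
  assumes "v \<in> F 2 0 \<union> F 1 1 \<union> F 0 2" "w \<in> W20 \<union> W11 \<union> W02"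
  shows "word (v # w) \<in> word_span s (\<lambda>_ _. 0) (W20 \<union> W11 \<union> W02)" (is "_ \<in> ?S")
proof -
  have S: "word (a # xs) \<in> ?S" "word xs \<in> ?S" "word (c # xs) \<in> ?S" "word (a # c # xs) \<in> ?S"
    if "a \<in> F 2 0" "c \<in> F 0 2" "set xs \<subseteq> F 1 1" for a c xs
    using that by (auto intro!: word_span.word simp: W20_def W02_def W11_def)
  have swap: "word (x # y # u) \<in> ?S" if "word (y # x # u) \<in> ?S" for x y u
  proof -
    have "word (x # y # u) - - word (y # x # u) \<in> N"
      using anticommute [of x y u] by simp
    then show ?thesis
      by (rule word_span_cong) (intro word_span_minus that)
  qed
  have left: "word (x # u) \<in> N" if "word u \<in> N" for x u
    using null_ideal.left [OF that, of x] by simp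
  have swap0: "word (x # y # u) \<in> N" if "word (y # x # u) \<in> N" for x y u
    using null_ideal_diff [OF anticommute [of x y u] that] by simp
  have swap': "word (x # y # z # u) \<in> ?S" if "word (x # z # y # u) \<in> ?S" for x y z u
  proof -
    have "word (x # y # z # u) + word (x # z # y # u) \<in> N"
      using null_ideal.left [OF anticommute [of y z u], of x] by (simp add: distrib_left)
    then have "word (x # y # z # u) - - word (x # z # y # u) \<in> N"
      by simp
    then show ?thesis
      by (rule word_span_cong) (intro word_span_minus that)
  qed
  have rep20: "word (a # a' # u) \<in> N" if "a \<in> F 2 0" "a' \<in> F 2 0" for a a' u
    using that F_20 by (intro repeated) auto
  have rep02: "word (a # a' # u) \<in> N" if "a \<in> F 0 2" "a' \<in> F 0 2" for a a' u
    using that F_02 by (intro repeated) auto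
  \<comment> \<open>Dummies: the rules \<open>S\<close> carry premises on both an \<open>a\<close>
    and a \<open>c\<close> even where only one of them occurs in the word.\<close>
  obtain a0 c0 where 0: "a0 \<in> F 2 0" "c0 \<in> F 0 2" using sum_F by blast
  have w: thesis
    if "\<And>a xs. w = a # xs \<Longrightarrow> a \<in> F 2 0 \<Longrightarrow> set xs \<subseteq> F 1 1 \<Longrightarrow> thesis"
      and "\<And>c xs. w = c # xs \<Longrightarrow> c \<in> F 0 2 \<Longrightarrow> set xs \<subseteq> F 1 1 \<Longrightarrow> thesis"
      and "set w \<subseteq> F 1 1 \<Longrightarrow> thesis"
      and "\<And>a c xs. w = a # c # xs \<Longrightarrow> a \<in> F 2 0 \<Longrightarrow> c \<in> F 0 2 \<Longrightarrow> set xs \<subseteq> F 1 1 \<Longrightarrow> thesis"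
    for thesis
    using assms(2) unfolding W20_def W02_def W11_def
    by (elim UnE CollectE exE conjE)
      (erule (2) that(1), erule that(3), erule (3) that(4), erule (2) that(2))
  from assms(1) consider "v \<in> F 2 0" | "v \<in> F 1 1" | "v \<in> F 0 2" by blast
  then show ?thesis
  proof cases
    case 1
    show ?thesis
    proof (rule w)
      fix a xs
      assume *: "w = a # xs" "a \<in> F 2 0" "set xs \<subseteq> F 1 1"
      show ?thesis unfolding *(1) by (rule word_span.null [OF rep20 [OF 1 *(2)]])
    next
      fix c xs
      assume *: "w = c # xs" "c \<in> F 0 2" "set xs \<subseteq> F 1 1"
      show ?thesis unfolding *(1) by (rule S(4) [OF 1 *(2,3)])
    next
      assume *: "set w \<subseteq> F 1 1"
      show ?thesis by (rule S(1) [OF 1 0(2) *])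
    next
      fix a c xs
      assume *: "w = a # c # xs" "a \<in> F 2 0" "c \<in> F 0 2" "set xs \<subseteq> F 1 1"
      show ?thesis unfolding *(1) by (rule word_span.null [OF rep20 [OF 1 *(2)]])
    qed
  next
    case 2
    have v: "set (v # xs) \<subseteq> F 1 1" if "set xs \<subseteq> F 1 1" for xs
      using 2 that by simp
    show ?thesis
    proof (rule w)
      fix a xs
      assume *: "w = a # xs" "a \<in> F 2 0" "set xs \<subseteq> F 1 1"
      show ?thesis unfolding *(1) by (rule swap [OF S(1) [OF *(2) 0(2) v [OF *(3)]]])
    next
      fix c xs
      assume *: "w = c # xs" "c \<in> F 0 2" "set xs \<subseteq> F 1 1"
      show ?thesis unfolding *(1) by (rule swap [OF S(3) [OF 0(1) *(2) v [OF *(3)]]])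
    next
      assume *: "set w \<subseteq> F 1 1"
      show ?thesis by (rule S(2) [OF 0 v [OF *]])
    next
      fix a c xs
      assume *: "w = a # c # xs" "a \<in> F 2 0" "c \<in> F 0 2" "set xs \<subseteq> F 1 1"
      show ?thesis unfolding *(1) by (rule swap [OF swap' [OF S(4) [OF *(2,3) v [OF *(4)]]]])
    qed
  next
    case 3
    show ?thesis
    proof (rule w)
      fix a xs
      assume *: "w = a # xs" "a \<in> F 2 0" "set xs \<subseteq> F 1 1"
      show ?thesis unfolding *(1) by (rule swap [OF S(4) [OF *(2) 3 *(3)]])
    next
      fix c xs
      assume *: "w = c # xs" "c \<in> F 0 2" "set xs \<subseteq> F 1 1"
      show ?thesis unfolding *(1) by (rule word_span.null [OF rep02 [OF 3 *(2)]])
    next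
      assume *: "set w \<subseteq> F 1 1"
      show ?thesis by (rule S(3) [OF 0(1) 3 *])
    next
      fix a c xs
      assume *: "w = a # c # xs" "a \<in> F 2 0" "c \<in> F 0 2" "set xs \<subseteq> F 1 1"
      \<comment> \<open>Once moved behind \<open>a\<close>, the new letter stands next to
        \<open>c\<close>, which has the same type.\<close>
      show ?thesis unfolding *(1) by (rule word_span.null [OF swap0 [OF left [OF rep02 [OF 3 *(3)]]]])
    qed
  qed
qed

lemma word_span_W: "p \<in> word_span s (\<lambda>_ _. 0) (W20 \<union> W11 \<union> W02)" (is "_ \<in> ?S")
proof (induction p rule: free_algebra_induct)
  case one
  have "[] \<in> W20 \<union> W11 \<union> W02" by (simp add: W11_def)
  from word_span.word [OF this] show ?case by simp
next
  case (word x p)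
  obtain a b c where abc: "a \<in> F 2 0" "b \<in> F 1 1" "c \<in> F 0 2" "x = a + b + c"
    using sum_F by blast
  have mult: "word [v] * p \<in> ?S" if "v \<in> F 2 0 \<union> F 1 1 \<union> F 0 2" for v
    using word by (rule word_span_mult) (simp add: word_span_W_mult [OF that])
  have "(word [a + b + c] - word [a + b] - word [c]) + (word [a + b] - word [a] - word [b]) \<in> N"
    by (intro null_ideal_add relator_null relator.additive)
  then have "((word [a + b + c] - word [a + b] - word [c]) +
      (word [a + b] - word [a] - word [b])) * p \<in> N"
    by (rule null_ideal_right)
  then have "word [x] * p - (word [a] * p + word [b] * p + word [c] * p) \<in> N"
    by (simp add: abc algebra_simps)
  then show ?case
    by (rule word_span_cong) (intro word_span.add mult, use abc in auto)
qed (simp_all add: word_span.intros)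

subsection \<open>Eigenspaces\<close>

text \<open>An eigenspace modulo the relations, hence saturated. The form is a parameter because
  eigenspaces of the exterior algebra, with zero form, are compared with those of the Clifford
  algebra.\<close>

definition eigen :: "('v \<Rightarrow> 'v \<Rightarrow> complex) \<Rightarrow> complex \<Rightarrow> ('v list \<Rightarrow>\<^sub>0 complex) set" where
  "eigen A d = {p. derivation D p - scale d p \<in> null_ideal s A}"

lemma derivation_N: "p \<in> N \<Longrightarrow> derivation D p \<in> N"
  by (rule bilinear_form.derivation_null [OF bilinear_form_zero]) (simp_all add: D_add D_scale)

lemma word_span_eigen:
  assumes "p \<in> word_span s (\<lambda>_ _. 0) A" "\<And>w. w \<in> A \<Longrightarrow> word w \<in> eigen (\<lambda>_ _. 0) d"
  shows "p \<in> eigen (\<lambda>_ _. 0) d"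
  using assms(1)
proof (induction rule: word_span.induct)
  case (null p)
  then show ?case
    by (simp add: eigen_def null_ideal_diff null_ideal_scale derivation_N)
next
  case (word w)
  then show ?case by (rule assms)
next
  case (add p q)
  then have "(derivation D p - scale d p) + (derivation D q - scale d q) \<in> N"
    by (intro null_ideal_add) (simp_all add: eigen_def)
  then show ?case by (simp add: eigen_def algebra_simps)
next
  case (scale p c)
  then have "scale c (derivation D p - scale d p) \<in> N"
    by (intro null_ideal_scale) (simp_all add: eigen_def)
  then show ?case by (simp add: eigen_def mult.commute)
qed

lemma derivation_word_mult':
  "derivation D (word (x # w) :: 'v list \<Rightarrow>\<^sub>0 complex) =
    word [D x] * word w + word [x] * derivation D (word w)"
  using derivation_word_mult [of D x "word w :: 'v list \<Rightarrow>\<^sub>0 complex"] by simp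

lemma derivation_F11: "set xs \<subseteq> F 1 1 \<Longrightarrow> derivation D (word xs) \<in> N"
proof (induction xs)
  case (Cons x xs)
  have "word [0] * word xs + word [x] * derivation D (word xs) \<in> N"
    using Cons by (intro null_ideal_add null_ideal_left null_ideal_right word_zero_null) simp
  then show ?case
    using Cons.prems derivation_word_mult' [of x xs] by (simp add: D_11)
qed simp

lemma W20_eigen: "w \<in> W20 \<Longrightarrow> word w \<in> eigen (\<lambda>_ _. 0) 1"
  unfolding W20_def
  by (elim CollectE exE conjE)
    (simp add: eigen_def derivation_word_mult' D_20 null_ideal_left derivation_F11)

lemma W02_word: "c \<in> F 0 2 \<Longrightarrow> set xs \<subseteq> F 1 1 \<Longrightarrow> word (c # xs) \<in> eigen (\<lambda>_ _. 0) (- 1)"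
proof -
  assume *: "c \<in> F 0 2" "set xs \<subseteq> F 1 1"
  then have "(word [- c] + word [c]) * word xs + word [c] * derivation D (word xs) \<in> N"
    by (intro null_ideal_add null_ideal_right null_ideal_left word_minus_null derivation_F11)
  then show ?thesis
    using * by (simp add: eigen_def derivation_word_mult' D_02 algebra_simps)
qed

lemma W02_eigen: "w \<in> W02 \<Longrightarrow> word w \<in> eigen (\<lambda>_ _. 0) (- 1)"
  unfolding W02_def by (elim CollectE exE conjE) (simp add: W02_word)

lemma W11_eigen: "w \<in> W11 \<Longrightarrow> word w \<in> eigen (\<lambda>_ _. 0) 0"
proof -
  have "word (a # c # xs) \<in> eigen (\<lambda>_ _. 0) 0" if "a \<in> F 2 0" "c \<in> F 0 2" "set xs \<subseteq> F 1 1" for a c xs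
  proof -
    have "word [a] * (derivation D (word (c # xs)) - scale (- 1) (word (c # xs))) \<in> N"
      using W02_word [OF that(2,3)] by (intro null_ideal_left) (simp add: eigen_def)
    then show ?thesis
      using that(1) derivation_word_mult' [of a "c # xs"] by (simp add: eigen_def D_20 algebra_simps)
  qed
  moreover have "word w \<in> eigen (\<lambda>_ _. 0) 0" if "set w \<subseteq> F 1 1"
    using derivation_F11 [OF that] by (simp add: eigen_def)
  ultimately show "w \<in> W11 \<Longrightarrow> word w \<in> eigen (\<lambda>_ _. 0) 0"
    unfolding W11_def by (elim UnE CollectE exE conjE) simp_all
qed

text \<open>Independence of eigenspaces modulo the relations. Applying \<open>D - d\<close> to the
  sum gives the null element \<open>x\<close>; applying \<open>D\<close> to it removes
  \<open>b\<close> and gives \<open>y\<close>, and once more gives \<open>z\<close>, with the sign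
  of \<open>c\<close> reversed. Sum and difference of \<open>y\<close> and \<open>z\<close> isolate
  \<open>a\<close> and \<open>c\<close>, up to a factor 2. A general \<open>d\<close> yields both
  uniqueness of decompositions and the absence of further eigenvalues.\<close>

lemma eigen_sum:
  assumes "bilinear_form s A" "\<And>x y. A (D x) y = - A x (D y)"
    and "a \<in> eigen A 1" "b \<in> eigen A 0" "c \<in> eigen A (- 1)" "a + b + c \<in> eigen A d"
  shows "scale (1 - d) a \<in> null_ideal s A" "scale d b \<in> null_ideal s A"
    and "scale (1 + d) c \<in> null_ideal s A"
proof -
  note null = bilinear_form.derivation_null [OF assms(1), of D, OF D_add D_scale assms(2)]
  define x where "x = scale (1 - d) a - scale d b - scale (1 + d) c"
  define y where "y = scale (1 - d) a + scale (1 + d) c"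
  define z where "z = scale (1 - d) a - scale (1 + d) c"
  have a: "derivation D a - a \<in> null_ideal s A" and b: "derivation D b \<in> null_ideal s A"
    and c: "derivation D c + c \<in> null_ideal s A"
    using assms(3-5) by (simp_all add: eigen_def)
  have "derivation D (a + b + c) - scale d (a + b + c) \<in> null_ideal s A"
    using assms(6) by (simp only: eigen_def mem_Collect_eq)
  from null_ideal_diff [OF null_ideal_diff [OF null_ideal_diff [OF this a] b] c]
  have "derivation D (a + b + c) - scale d (a + b + c) - (derivation D a - a) - derivation D b
      - (derivation D c + c) \<in> null_ideal s A" .
  moreover have "derivation D (a + b + c) - scale d (a + b + c) - (derivation D a - a) - derivation D b
      - (derivation D c + c) = x"
    by (simp add: x_def scale_diff_left scale_add_left)
  ultimately have x: "x \<in> null_ideal s A"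
    by (rule back_subst [where P = "\<lambda>r. r \<in> null_ideal s A"])
  from null_ideal_add [OF null_ideal_add [OF null_ideal_diff [OF null [OF x]
    null_ideal_scale [OF a, of "1 - d"]] null_ideal_scale [OF b, of d]]
    null_ideal_scale [OF c, of "1 + d"]]
  have y: "y \<in> null_ideal s A"
    by (simp add: x_def y_def)
  from null_ideal_diff [OF null_ideal_diff [OF null [OF y] null_ideal_scale [OF a, of "1 - d"]]
    null_ideal_scale [OF c, of "1 + d"]]
  have z: "z \<in> null_ideal s A"
    by (simp add: y_def z_def)
  have two: "p \<in> null_ideal s A" if "p + p \<in> null_ideal s A" for p
    using scale_null_cancel [of 2 p s A] that scale_add_left [of 1 1 p] by simp
  show a': "scale (1 - d) a \<in> null_ideal s A"
    using null_ideal_add [OF y z]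
    by (rule two [OF back_subst [where P = "\<lambda>r. r \<in> null_ideal s A"]]) (simp add: y_def z_def)
  show c': "scale (1 + d) c \<in> null_ideal s A"
    using null_ideal_diff [OF y z]
    by (rule two [OF back_subst [where P = "\<lambda>r. r \<in> null_ideal s A"]]) (simp add: y_def z_def)
  show "scale d b \<in> null_ideal s A"
    using null_ideal_diff [OF null_ideal_diff [OF a' c'] x] by (simp add: x_def)
qed

lemma exterior_decomposition:
  obtains a b c where "a \<in> word_span s (\<lambda>_ _. 0) W20" "b \<in> word_span s (\<lambda>_ _. 0) W11"
    "c \<in> word_span s (\<lambda>_ _. 0) W02" "p = a + b + c"
proof -
  obtain q c where q: "q \<in> word_span s (\<lambda>_ _. 0) (W20 \<union> W11)"
    and c: "c \<in> word_span s (\<lambda>_ _. 0) W02" "p = q + c"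
    using word_span_Un [OF word_span_W [of p]] by blast
  obtain a b where "a \<in> word_span s (\<lambda>_ _. 0) W20" "b \<in> word_span s (\<lambda>_ _. 0) W11" "q = a + b"
    using word_span_Un [OF q] by blast
  then show thesis using c by (intro that [of a b c]) simp_all
qed

text \<open>The three parts consist of eigenvectors and together span everything. In an eigenvector
  each component with another eigenvalue is therefore null by \<open>eigen_sum\<close>; for a
  foreign \<open>d\<close> all three are.\<close>

lemma word_span_iff_eigen:
  shows "p \<in> word_span s (\<lambda>_ _. 0) W20 \<longleftrightarrow> p \<in> eigen (\<lambda>_ _. 0) 1"
    and "p \<in> word_span s (\<lambda>_ _. 0) W11 \<longleftrightarrow> p \<in> eigen (\<lambda>_ _. 0) 0"
    and "p \<in> word_span s (\<lambda>_ _. 0) W02 \<longleftrightarrow> p \<in> eigen (\<lambda>_ _. 0) (- 1)"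
    and "d \<notin> {1, 0, - 1} \<Longrightarrow> p \<in> eigen (\<lambda>_ _. 0) d \<Longrightarrow> p \<in> N"
proof -
  obtain a b c where abc: "a \<in> word_span s (\<lambda>_ _. 0) W20" "b \<in> word_span s (\<lambda>_ _. 0) W11"
    "c \<in> word_span s (\<lambda>_ _. 0) W02" "p = a + b + c"
    by (rule exterior_decomposition)
  have eigen: "a \<in> eigen (\<lambda>_ _. 0) 1" "b \<in> eigen (\<lambda>_ _. 0) 0" "c \<in> eigen (\<lambda>_ _. 0) (- 1)"
    using word_span_eigen [OF abc(1) W20_eigen] word_span_eigen [OF abc(2) W11_eigen]
      word_span_eigen [OF abc(3) W02_eigen] by simp_all
  have sum: "scale (1 - d) a \<in> N" "scale d b \<in> N" "scale (1 + d) c \<in> N"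
    if "p \<in> eigen (\<lambda>_ _. 0) d" for d
    using eigen_sum [OF bilinear_form_zero _ eigen that [unfolded abc(4)]] by simp_all
  show "p \<in> word_span s (\<lambda>_ _. 0) W20 \<longleftrightarrow> p \<in> eigen (\<lambda>_ _. 0) 1"
  proof
    assume "p \<in> eigen (\<lambda>_ _. 0) 1"
    from sum [OF this] have "b \<in> N" "c \<in> N"
      by (simp_all add: scale_null_cancel [of 2 c])
    then show "p \<in> word_span s (\<lambda>_ _. 0) W20"
      using abc by (simp add: word_span.add word_span.null)
  qed (rule word_span_eigen [OF _ W20_eigen])
  show "p \<in> word_span s (\<lambda>_ _. 0) W11 \<longleftrightarrow> p \<in> eigen (\<lambda>_ _. 0) 0"
  proof
    assume "p \<in> eigen (\<lambda>_ _. 0) 0"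
    from sum [OF this] have "a \<in> N" "c \<in> N"
      by simp_all
    then show "p \<in> word_span s (\<lambda>_ _. 0) W11"
      using abc by (simp add: word_span.add word_span.null)
  qed (rule word_span_eigen [OF _ W11_eigen])
  show "p \<in> word_span s (\<lambda>_ _. 0) W02 \<longleftrightarrow> p \<in> eigen (\<lambda>_ _. 0) (- 1)"
  proof
    assume "p \<in> eigen (\<lambda>_ _. 0) (- 1)"
    from sum [OF this] have "a \<in> N" "b \<in> N"
      using null_ideal_minus [of "- b"] by (simp_all add: scale_null_cancel [of 2 a])
    then show "p \<in> word_span s (\<lambda>_ _. 0) W02"
      using abc by (simp add: word_span.add word_span.null)
  qed (rule word_span_eigen [OF _ W02_eigen])
  assume d: "d \<notin> {1, 0, - 1}" and "p \<in> eigen (\<lambda>_ _. 0) d"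
  from sum [OF this(2)] have "a \<in> N" "b \<in> N" "c \<in> N"
    using d by (auto elim!: scale_null_cancel simp: add_eq_0_iff)
  then show "p \<in> N"
    by (simp add: abc(4) null_ideal_add)
qed

lemma symbol_eigen: "symbol B p \<in> eigen (\<lambda>_ _. 0) d \<longleftrightarrow> p \<in> eigen B d"
proof -
  have "derivation D (symbol B p) - scale d (symbol B p) = symbol B (derivation D p - scale d p)"
    by (simp add: derivation_symbol [of B D, OF D_skew])
  then show ?thesis by (simp only: eigen_def mem_Collect_eq symbol_null_iff)
qed

section \<open>Types of the Clifford algebra as eigenspaces\<close>

abbreviation "\<gamma> \<equiv> clifford_class s B"

lemma clifford_hodge_class:
  "\<gamma> p \<in> clifford_hodge s B F i j \<longleftrightarrow> to_exterior s B (\<gamma> p) \<in> exterior_hodge s F i j"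
  by (simp add: clifford_hodge_def clifford_algebra rangeI)

lemma clifford_hodge_iff:
  "\<gamma> p \<in> clifford_hodge s B F 2 0 \<longleftrightarrow> p \<in> eigen B 1"
  "\<gamma> p \<in> clifford_hodge s B F 1 1 \<longleftrightarrow> p \<in> eigen B 0"
  "\<gamma> p \<in> clifford_hodge s B F 0 2 \<longleftrightarrow> p \<in> eigen B (- 1)"
  by (simp_all add: clifford_hodge_class to_exterior_class exterior_hodge_20 exterior_hodge_11
      exterior_hodge_02 exterior_class_iff word_span_iff_eigen symbol_eigen)

lemma clifford_hodge_other:
  assumes "(i, j) \<notin> {(2, 0), (1, 1), (0, 2)}"
  shows "clifford_hodge s B F i j = {\<gamma> 0}"
proof -
  have "exterior_hodge s F i j = {exterior_class s 0}"
    using assms by (auto simp: exterior_hodge_def clifford_algebra)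
  then have "\<gamma> p \<in> clifford_hodge s B F i j \<longleftrightarrow> \<gamma> p = \<gamma> 0" for p
    by (simp add: clifford_hodge_class to_exterior_class clifford_class_eq_iff symbol_null_iff)
  moreover have "clifford_hodge s B F i j \<subseteq> range \<gamma>"
    by (auto simp: clifford_hodge_def clifford_algebra)
  ultimately show ?thesis by blast
qed

lemma eigen_other: "d \<notin> {1, 0, - 1} \<Longrightarrow> p \<in> eigen B d \<Longrightarrow> p \<in> null_ideal s B"
  using word_span_iff_eigen(4) [of d "symbol B p"] by (simp add: symbol_eigen symbol_null_iff)

lemma null_eigen: "p \<in> null_ideal s B \<Longrightarrow> p \<in> eigen B d"
  by (simp add: eigen_def null_ideal_diff null_ideal_scale derivation_null [of D, OF D_add D_scale D_skew])

text \<open>On the line \<open>i + j = 2\<close> this covers also the types that do not occur, because \<open>D\<close> has no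
  eigenvalues other than \<open>1\<close>, \<open>0\<close> and \<open>- 1\<close>.\<close>

lemma clifford_hodge_iff_eigen:
  assumes "i + j = 2"
  shows "\<gamma> p \<in> clifford_hodge s B F i j \<longleftrightarrow> p \<in> eigen B (of_int (i - 1))"
proof (cases "(i, j) \<in> {(2, 0), (1, 1), (0, 2)}")
  case True
  then show ?thesis using clifford_hodge_iff by auto
next
  case False
  then have "i - 1 \<notin> {1, 0, - 1}"
    using assms by auto
  then have "(of_int (i - 1) :: complex) \<notin> {of_int 1, of_int 0, of_int (- 1)}"
    by (auto simp only: of_int_eq_iff insert_iff empty_iff)
  then have "(of_int (i - 1) :: complex) \<notin> {1, 0, - 1}"
    by simp
  then have "p \<in> eigen B (of_int (i - 1)) \<longleftrightarrow> p \<in> null_ideal s B"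
    using eigen_other null_eigen by blast
  then show ?thesis
    by (simp only: clifford_hodge_other [OF False] clifford_class_eq_iff singleton_iff diff_zero)
qed

lemma clifford_hodge_eigen: "\<exists>d. \<forall>p. \<gamma> p \<in> clifford_hodge s B F i j \<longleftrightarrow> p \<in> eigen B d"
proof (cases "i + j = 2")
  case True
  then show ?thesis using clifford_hodge_iff_eigen by blast
next
  case False
  then have "(i, j) \<notin> {(2, 0), (1, 1), (0, 2)}" by auto
  note * = clifford_hodge_other [OF this]
  \<comment> \<open>The value 2 stands for any number that is not an eigenvalue: its eigenspace is
    the null ideal.\<close>
  have "p \<in> eigen B 2 \<longleftrightarrow> p \<in> null_ideal s B" for p
    using eigen_other [of 2] null_eigen by auto
  then show ?thesis
    by (intro exI [of _ 2]) (simp add: * clifford_class_eq_iff)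
qed

lemma clifford_hodge_subset: "clifford_hodge s B F i j \<subseteq> range \<gamma>"
  by (auto simp: clifford_hodge_def clifford_algebra)

lemma eigen_closed:
  "0 \<in> eigen A d" "p \<in> eigen A d \<Longrightarrow> q \<in> eigen A d \<Longrightarrow> p + q \<in> eigen A d"
  "p \<in> eigen A d \<Longrightarrow> scale k p \<in> eigen A d"
proof -
  show "0 \<in> eigen A d" by (simp add: eigen_def)
  show "p + q \<in> eigen A d" if "p \<in> eigen A d" "q \<in> eigen A d"
    using null_ideal_add [of "derivation D p - scale d p" s A "derivation D q - scale d q"] that
    by (simp add: eigen_def algebra_simps)
  show "scale k p \<in> eigen A d" if "p \<in> eigen A d"
    using null_ideal_scale [of "derivation D p - scale d p" s A k] that
    by (simp add: eigen_def mult.commute)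
qed

lemma submodule_clifford_hodge:
  "submodule (clifford_hodge s B F i j) scalar_ring (clifford_algebra s B)"
proof -
  obtain d where d: "\<forall>p. \<gamma> p \<in> clifford_hodge s B F i j \<longleftrightarrow> p \<in> eigen B d"
    using clifford_hodge_eigen by blast
  have "clifford_hodge s B F i j = \<gamma> ` eigen B d"
    using d clifford_hodge_subset [of i j] by blast
  then show ?thesis
    by (simp add: submodule_clifford_class eigen_closed)
qed

section \<open>Products, decomposition and conjugation\<close>

lemma eigen_mult:
  assumes "p \<in> eigen B d" "q \<in> eigen B e"
  shows "p * q \<in> eigen B (d + e)"
proof -
  have "(derivation D p - scale d p) * q + p * (derivation D q - scale e q) \<in> null_ideal s B"
    using assms by (intro null_ideal_add null_ideal_left null_ideal_right) (simp_all add: eigen_def)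
  then show ?thesis
    by (simp add: eigen_def derivation_mult scale_add_left algebra_simps)
qed

lemma clifford_hodge_null:
  assumes "\<gamma> p \<in> clifford_hodge s B F i j" "i + j \<noteq> 2"
  shows "p \<in> null_ideal s B"
proof -
  from assms(2) have other: "(i, j) \<notin> {(2, 0), (1, 1), (0, 2)}" by auto
  from assms(1) show ?thesis
    by (simp add: clifford_hodge_other [OF other] clifford_class_eq_iff)
qed

lemma null_clifford_hodge: "p \<in> null_ideal s B \<Longrightarrow> \<gamma> p \<in> clifford_hodge s B F i j"
  using submodule_clifford_classD(2) [OF submodule_clifford_hodge [of i j]]
    clifford_class_eq_iff [of s B p 0] by simp

text \<open>Off the line \<open>i + j = 2\<close> a factor is zero. On it the eigenvalues
  \<open>i - 1\<close> and \<open>k - 1\<close> add up to \<open>(i + k - 1) - 1\<close>, the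
  eigenvalue of the asserted type; if that type does not occur, its eigenspace is null.\<close>

lemma clifford_hodge_mult:
  assumes "X \<in> clifford_hodge s B F i j" "Y \<in> clifford_hodge s B F k l"
  shows "X \<otimes>\<^bsub>clifford_algebra s B\<^esub> Y \<in> clifford_hodge s B F (i + k - 1) (j + l - 1)"
proof -
  obtain p q where [simp]: "X = \<gamma> p" "Y = \<gamma> q"
    using assms clifford_hodge_subset by blast
  consider "i + j \<noteq> 2" | "k + l \<noteq> 2" | "i + j = 2" "k + l = 2" by blast
  then have "\<gamma> (p * q) \<in> clifford_hodge s B F (i + k - 1) (j + l - 1)"
  proof cases
    case 1
    then show ?thesis
      using assms(1) by (simp add: null_clifford_hodge null_ideal_right clifford_hodge_null)
  next
    case 2
    then show ?thesis
      using assms(2) by (simp add: null_clifford_hodge null_ideal_left clifford_hodge_null)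
  next
    case 3
    then have "(i + k - 1) + (j + l - 1) = 2" by simp
    then show ?thesis
      using eigen_mult [of p "of_int (i - 1)" q "of_int (k - 1)"] assms
      by (simp add: clifford_hodge_iff_eigen 3 algebra_simps)
  qed
  then show ?thesis by (simp add: clifford_algebra)
qed

lemma clifford_hodge_decomposition:
  assumes "X \<in> carrier (clifford_algebra s B)"
  shows "\<exists>!(a, b, c). a \<in> clifford_hodge s B F 2 0 \<and> b \<in> clifford_hodge s B F 1 1 \<and>
    c \<in> clifford_hodge s B F 0 2 \<and> X = a \<oplus>\<^bsub>clifford_algebra s B\<^esub> b \<oplus>\<^bsub>clifford_algebra s B\<^esub> c"
proof -
  obtain p where X: "X = \<gamma> p"
    using assms by (rule clifford_class_cases)
  obtain a b c where abc: "a \<in> word_span s (\<lambda>_ _. 0) W20" "b \<in> word_span s (\<lambda>_ _. 0) W11"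
    "c \<in> word_span s (\<lambda>_ _. 0) W02" "symbol B p = a + b + c"
    by (rule exterior_decomposition)
  let ?inv = "symbol (\<lambda>x y. - B x y)"
  \<comment> \<open>The decomposition is taken in the exterior algebra and carried back by the
    inverse identification.\<close>
  have p: "p = ?inv a + ?inv b + ?inv c"
    using symbol_inverse [of B p] by (simp add: abc(4))
  have eigen: "?inv a \<in> eigen B 1" "?inv b \<in> eigen B 0" "?inv c \<in> eigen B (- 1)"
    using abc(1-3) by (simp_all add: word_span_iff_eigen symbol_inverse' flip: symbol_eigen)
  have unique: "\<gamma> u = \<gamma> (?inv a) \<and> \<gamma> v = \<gamma> (?inv b) \<and> \<gamma> w = \<gamma> (?inv c)"
    if "u \<in> eigen B 1" "v \<in> eigen B 0" "w \<in> eigen B (- 1)" "X = \<gamma> (u + v + w)" for u v w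
  proof -
    have diff: "x - y \<in> eigen B d" if "x \<in> eigen B d" "y \<in> eigen B d" for x y d
      using eigen_closed(2) [OF that(1) eigen_closed(3) [OF that(2), of "- 1"]] by simp
    define u' v' w' where "u' = u - ?inv a" and "v' = v - ?inv b" and "w' = w - ?inv c"
    have e: "u' \<in> eigen B 1" "v' \<in> eigen B 0" "w' \<in> eigen B (- 1)"
      unfolding u'_def v'_def w'_def by (intro diff that eigen)+
    have "(u + v + w) - (?inv a + ?inv b + ?inv c) \<in> null_ideal s B"
      using that(4) p X by (metis clifford_class_eq_iff)
    also have "(u + v + w) - (?inv a + ?inv b + ?inv c) = u' + v' + w'"
      by (simp add: u'_def v'_def w'_def)
    \<comment> \<open>A null element belongs to the eigenspace of every \<open>d\<close>. In
      \<open>eigen_sum\<close>, the value \<open>d = 0\<close> kills the two outer differences and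
      \<open>d = 1\<close> the middle one.\<close>
    finally have "u' + v' + w' \<in> eigen B d" for d
      by (rule null_eigen)
    note * = eigen_sum [OF bilinear_form_axioms D_skew e this]
    have "scale 1 u' \<in> null_ideal s B" "scale 1 v' \<in> null_ideal s B" "scale 1 w' \<in> null_ideal s B"
      using *(1,3) [of 0] *(2) [of 1] by simp_all
    then show ?thesis
      by (simp add: clifford_class_eq_iff u'_def v'_def w'_def)
  qed
  show ?thesis
  proof (rule ex1I [of _ "(\<gamma> (?inv a), \<gamma> (?inv b), \<gamma> (?inv c))"])
    show "case (\<gamma> (?inv a), \<gamma> (?inv b), \<gamma> (?inv c)) of (a, b, c) \<Rightarrow>
      a \<in> clifford_hodge s B F 2 0 \<and> b \<in> clifford_hodge s B F 1 1 \<and>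
      c \<in> clifford_hodge s B F 0 2 \<and> X = a \<oplus>\<^bsub>clifford_algebra s B\<^esub> b \<oplus>\<^bsub>clifford_algebra s B\<^esub> c"
      using eigen p by (simp add: clifford_hodge_iff clifford_algebra X)
  next
    fix t
    assume t: "case t of (a, b, c) \<Rightarrow>
      a \<in> clifford_hodge s B F 2 0 \<and> b \<in> clifford_hodge s B F 1 1 \<and>
      c \<in> clifford_hodge s B F 0 2 \<and> X = a \<oplus>\<^bsub>clifford_algebra s B\<^esub> b \<oplus>\<^bsub>clifford_algebra s B\<^esub> c"
    obtain x y z where t': "t = (x, y, z)" by (cases t)
    with t have xyz: "x \<in> clifford_hodge s B F 2 0" "y \<in> clifford_hodge s B F 1 1"
      "z \<in> clifford_hodge s B F 0 2" "X = x \<oplus>\<^bsub>clifford_algebra s B\<^esub> y \<oplus>\<^bsub>clifford_algebra s B\<^esub> z"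
      by simp_all
    obtain u v w where uvw: "x = \<gamma> u" "y = \<gamma> v" "z = \<gamma> w"
      using xyz(1-3) [THEN subsetD [OF clifford_hodge_subset]] by blast
    show "t = (\<gamma> (?inv a), \<gamma> (?inv b), \<gamma> (?inv c))"
      using unique [of u v w] xyz by (simp add: t' uvw clifford_hodge_iff clifford_algebra)
  qed
qed

text \<open>Conjugation is only assumed to anticommute with \<open>D\<close> on \<open>V\<close>; on the free algebra this
  persists up to the relations \<open>word [- x] = - word [x]\<close>.\<close>

lemma clifford_hodge_conjugate:
  assumes "\<And>x y. f (x + y) = f x + f y" "\<And>c x. f (s c x) = s (cnj c) (f x)"
    and "\<And>x. B (f x) (f x) = cnj (B x x)" and "\<And>x. D (f x) = - f (D x)"
    and "\<gamma> p \<in> clifford_hodge s B F i j"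
  shows "\<gamma> (free_map cnj f p) \<in> clifford_hodge s B F j i"
proof -
  interpret ring_hom1 cnj by standard simp_all
  have comm: "derivation D (free_map cnj f q) + free_map cnj f (derivation D q) \<in> null_ideal s B" for q
  proof (induction q rule: free_algebra_induct)
    case (add p q)
    from null_ideal_add [OF this] show ?case by (simp add: algebra_simps)
  next
    case (scale c p)
    from null_ideal_scale [OF this, of "cnj c"] show ?case by simp
  next
    case (word x p)
    have "(word [- f (D x)] + word [f (D x)]) * free_map cnj f p + word [f x] *
        (derivation D (free_map cnj f p) + free_map cnj f (derivation D p)) \<in> null_ideal s B"
      by (intro null_ideal_add null_ideal_left null_ideal_right word_minus_null word)
    then show ?case by (simp add: assms(4) algebra_simps)
  qed simp
  note null = free_map_null [of f s s B B, OF assms(1-3)]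
  show ?thesis
  proof (cases "i + j = 2")
    case True
    let ?d = "of_int (i - 1) :: complex"
    have "derivation D p - scale ?d p \<in> null_ideal s B"
      using assms(5) True by (simp add: clifford_hodge_iff_eigen eigen_def)
    from null_ideal_diff [OF comm [of p] null [OF this]]
    have "derivation D (free_map cnj f p) + free_map cnj f (derivation D p) -
        free_map cnj f (derivation D p - scale ?d p) \<in> null_ideal s B" .
    moreover have "derivation D (free_map cnj f p) + free_map cnj f (derivation D p) -
        free_map cnj f (derivation D p - scale ?d p) =
        derivation D (free_map cnj f p) - scale (- ?d) (free_map cnj f p)"
      by (simp del: of_int_diff)
    ultimately have "derivation D (free_map cnj f p) - scale (- ?d) (free_map cnj f p) \<in> null_ideal s B"
      by (rule back_subst [where P = "\<lambda>r. r \<in> null_ideal s B"])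
    moreover have j: "j = 2 - i" using True by simp
    then have "of_int (j - 1) = - ?d" and "j + i = 2" by simp_all
    ultimately show ?thesis
      by (simp only: clifford_hodge_iff_eigen eigen_def mem_Collect_eq)
  next
    case False
    show ?thesis
      by (intro null_clifford_hodge null clifford_hodge_null [OF assms(5) False])
  qed
qed

end

section \<open>The Hodge structure on the Clifford algebra\<close>

lemma subseqs_map: "subseqs (map f xs) = map (map f) (subseqs xs)"
  by (induction xs) (simp_all add: Let_def)

lemma bilinear_form_module_of:
  assumes "bilinear_map (module_of s) (module_of s) (module_of (*)) B"
  shows "bilinear_form s B"
  using assms unfolding bilinear_map_def bilinear_form_def by (simp add: module_of_def)

lemma submodule_module_ofD:
  assumes "module scalar_ring (module_of s)" "submodule N scalar_ring (module_of s)"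
  shows "0 \<in> N" "x \<in> N \<Longrightarrow> y \<in> N \<Longrightarrow> x + y \<in> N" "x \<in> N \<Longrightarrow> s c x \<in> N"
  using subgroup.one_closed [OF submodule.axioms(1) [OF assms(2)]]
    module.submoduleE(5) [OF assms, of x y] module.submoduleE(4) [OF assms, of c x]
  by (simp_all add: module_of_def scalar_ring_def)

lemma (in bilinear_form) form_sum:
  "B (\<Sum>a\<in>A. s (c a) a) (\<Sum>b\<in>A. s (d b) b) = (\<Sum>a\<in>A. \<Sum>b\<in>A. c a * d b * B a b)"
proof -
  have zero: "B 0 y = 0" "B x 0 = 0" for x y
    using add_left [of 0 0 y] add_right [of x 0 0] by simp_all
  have right: "B x (\<Sum>b\<in>X. s (d b) b) = (\<Sum>b\<in>X. d b * B x b)" for x X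
    by (induction X rule: infinite_finite_induct) (simp_all add: zero add_right scale_right)
  have left: "B (\<Sum>a\<in>X. s (c a) a) y = (\<Sum>a\<in>X. c a * B a y)" for y X
    by (induction X rule: infinite_finite_induct) (simp_all add: zero add_left scale_left)
  show ?thesis
    by (simp only: left) (simp add: right sum_distrib_left mult.assoc)
qed

text \<open>\<open>complexified_lattice\<close> asks \<open>\<iota>\<close> only to be additive;
  compatibility with integer multiples follows by induction in both directions from 0.\<close>

lemma additive_int_scale:
  assumes "module scalar_ring (module_of sZ)" "module scalar_ring (module_of s)"
    and add: "\<And>x y. f (x + y) = f x + f y"
  shows "f (sZ n x) = s (of_int n :: 'r::comm_ring_1) (f x)"
proof -
  note Z = module_ofD [OF assms(1)] and C = module_ofD [OF assms(2)]
  have zero: "sZ 0 x = 0" "s 0 (f x) = 0" "f 0 = 0"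
    using Z(1) [of 0 0 x] C(1) [of 0 0 "f x"] add [of 0 0] by simp_all
  show ?thesis
  proof (induction n rule: int_induct [where k = 0])
    case base
    then show ?case by (simp add: zero)
  next
    case (step1 i)
    then show ?case by (simp add: Z C add)
  next
    case (step2 i)
    have "f (sZ (i - 1) x) + f x = f (sZ i x)"
      using Z(1) [of "i - 1" 1 x] by (simp add: Z(4) add)
    moreover have "s (of_int (i - 1)) (f x) + f x = s (of_int i) (f x)"
      using C(1) [of "of_int (i - 1)" 1 "f x"] by (simp add: C(4))
    ultimately show ?case using step2 by (metis add_right_imp_eq)
  qed
qed

lemma one_dimensional:
  fixes s :: "complex \<Rightarrow> 'v::ab_group_add \<Rightarrow> 'v"
  assumes "module scalar_ring (module_of s)" "vector_space.dim s U = 1"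
  shows "\<exists>v. U \<subseteq> range (\<lambda>c. s c v)"
proof -
  interpret vector_space s
    using module_ofD [OF assms(1)] by unfold_locales simp_all
  obtain A where A: "A \<subseteq> U" "U \<subseteq> span A" "card A = dim U"
    using basis_exists [of U] by metis
  then obtain v where "A = {v}"
    using assms(2) card_1_singletonE by metis
  then show ?thesis
    using A(2) by (auto simp: span_singleton)
qed

section \<open>The operator \<open>D\<close> of a polarized Hodge structure\<close>

locale polarized_structure =
  polarized_hodge_structure2 "module_of sZ" "module_of sC" \<iota> cj F Q QC
  for sZ :: "int \<Rightarrow> 'h \<Rightarrow> 'h::ab_group_add" and sC :: "complex \<Rightarrow> 'v \<Rightarrow> 'v::ab_group_add"
    and \<iota> cj F Q QC +
  assumes dim_20: "vector_space.dim sC (F 2 0) = 1"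
begin

lemma module_Z: "module scalar_ring (module_of sZ)"
  and module_C: "module scalar_ring (module_of sC)"
  and \<iota>_add: "\<iota> (x + y) = \<iota> x + \<iota> y"
  using lattice by (simp_all add: complexified_lattice_def module_of_def)

lemma \<iota>_scale: "\<iota> (sZ n x) = sC (of_int n) (\<iota> x)"
  by (rule additive_int_scale [OF module_Z module_C \<iota>_add])

lemma conj_add: "cj (x + y) = cj x + cj y"
  and conj_scale: "cj (sC c x) = sC (cnj c) (cj x)"
  and conj_\<iota>: "cj (\<iota> z) = \<iota> z"
  using cj_add [of x y] cj_smult [of x c] cj_lattice by (simp_all add: module_of_def)

lemma conj_zero: "cj 0 = 0"
  using conj_add [of 0 0] by simp

lemma conj_minus: "cj (- x) = - cj x"
  using conj_add [of x "- x"] by (simp add: conj_zero eq_neg_iff_add_eq_0 add.commute)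

lemma Q_form: "bilinear_form sZ Q"
  by (rule bilinear_form_module_of) (rule form_bilinear)

lemma QC_form: "bilinear_form sC QC"
  by (rule bilinear_form_module_of) (rule formC_bilinear)

lemma QC_\<iota>: "QC (\<iota> x) (\<iota> y) = of_int (Q x y)"
  by (rule formC_extends) (simp_all add: module_of_def)

lemma F_closed: "0 \<in> F p q" "x \<in> F p q \<Longrightarrow> y \<in> F p q \<Longrightarrow> x + y \<in> F p q"
  "x \<in> F p q \<Longrightarrow> sC c x \<in> F p q"
  using submodule_module_ofD [OF module_C subspace] by blast+

lemma conj_F: "x \<in> F p q \<Longrightarrow> cj x \<in> F q p"
  using cj_types [of p q] by blast

lemma basis:
  obtains A where "finite_basis (module_of sZ) A" "inj_on \<iota> A" "finite_basis (module_of sC) (\<iota> ` A)"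
  using lattice unfolding complexified_lattice_def by blast

text \<open>The image of a lattice basis consists of vectors fixed by \<open>cj\<close>, so
  \<open>cj\<close> conjugates the coordinates in that basis. The form has integral, hence real,
  values on the basis vectors.\<close>

lemma conj_conj: "cj (cj x) = x" and QC_conj: "QC (cj x) (cj x) = cnj (QC x x)"
proof -
  obtain A where A: "finite_basis (module_of sC) (\<iota> ` A)"
    by (rule basis)
  let ?A = "\<iota> ` A" and ?f = "\<lambda>b. coordinate sC (\<iota> ` A) b x"
  have x: "x = (\<Sum>b\<in>?A. sC (?f b) b)"
    by (rule coordinate [OF module_C A])
  have conj: "cj (\<Sum>b\<in>X. sC (c b) b) = (\<Sum>b\<in>X. sC (cnj (c b)) b)" if "X \<subseteq> range \<iota>" for X c
    using that
    by (induction X rule: infinite_finite_induct)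
      (auto simp: conj_zero conj_add conj_scale conj_\<iota>)
  have A': "?A \<subseteq> range \<iota>" by blast
  have cx: "cj x = (\<Sum>b\<in>?A. sC (cnj (?f b)) b)"
    by (subst x) (rule conj [OF A'])
  have "cj (cj x) = (\<Sum>b\<in>?A. sC (?f b) b)"
    unfolding cx conj [OF A'] by simp
  then show "cj (cj x) = x" using x by simp
  have real: "cnj (QC a b) = QC a b" if "a \<in> ?A" "b \<in> ?A" for a b
    using that by (auto simp: QC_\<iota>)
  have "cnj (QC x x) = cnj (\<Sum>a\<in>?A. \<Sum>b\<in>?A. ?f a * ?f b * QC a b)"
    by (subst (1 2) x) (simp add: bilinear_form.form_sum [OF QC_form])
  also have "\<dots> = (\<Sum>a\<in>?A. \<Sum>b\<in>?A. cnj (?f a) * cnj (?f b) * QC a b)"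
    by (simp add: cnj_sum real cong: sum.cong)
  also have "\<dots> = QC (cj x) (cj x)"
    unfolding cx by (simp add: bilinear_form.form_sum [OF QC_form])
  finally show "QC (cj x) (cj x) = cnj (QC x x)" by simp
qed

definition D :: "'v \<Rightarrow> 'v" where
  "D x = (THE y. \<exists>a b c. a \<in> F 2 0 \<and> b \<in> F 1 1 \<and> c \<in> F 0 2 \<and> x = a + b + c \<and> y = a - c)"

lemma sum_F: "\<exists>a\<in>F 2 0. \<exists>b\<in>F 1 1. \<exists>c\<in>F 0 2. x = a + b + c"
  using ex1_implies_ex [OF decomposition [of x]] by (auto simp: module_of_def)

lemma sum_F_unique:
  assumes "a \<in> F 2 0" "b \<in> F 1 1" "c \<in> F 0 2" "a' \<in> F 2 0" "b' \<in> F 1 1" "c' \<in> F 0 2"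
    "a + b + c = a' + b' + c'"
  shows "a = a' \<and> b = b' \<and> c = c'"
proof -
  have "\<exists>!(u, v, w). u \<in> F 2 0 \<and> v \<in> F 1 1 \<and> w \<in> F 0 2 \<and> a + b + c = u + v + w"
    using decomposition [of "a + b + c"] by (simp add: module_of_def)
  then obtain t where t: "\<And>u v w. u \<in> F 2 0 \<Longrightarrow> v \<in> F 1 1 \<Longrightarrow> w \<in> F 0 2 \<Longrightarrow>
      a + b + c = u + v + w \<Longrightarrow> (u, v, w) = t"
    by (elim ex1E) auto
  have "(a, b, c) = t" "(a', b', c') = t"
    using assms by (auto intro!: t)
  then show ?thesis by (auto simp del: split_paired_All)
qed

lemma D_eq:
  assumes "a \<in> F 2 0" "b \<in> F 1 1" "c \<in> F 0 2"
  shows "D (a + b + c) = a - c"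
  unfolding D_def
proof (rule the_equality)
  show "\<exists>a' b' c'. a' \<in> F 2 0 \<and> b' \<in> F 1 1 \<and> c' \<in> F 0 2 \<and> a + b + c = a' + b' + c' \<and> a - c = a' - c'"
    using assms by blast
  fix y assume "\<exists>a' b' c'. a' \<in> F 2 0 \<and> b' \<in> F 1 1 \<and> c' \<in> F 0 2 \<and> a + b + c = a' + b' + c' \<and> y = a' - c'"
  then show "y = a - c"
    using sum_F_unique [OF assms] by blast
qed

text \<open>Orthogonality is assumed for the hermitian form; inserting \<open>cj b\<close>, of type
  (s, r), translates it to the bilinear one.\<close>

lemma QC_orthogonal:
  "a \<in> F p q \<Longrightarrow> b \<in> F r s \<Longrightarrow> (p, q) \<noteq> (s, r) \<Longrightarrow> QC a b = 0"
  using orthogonal [of p q s r a "cj b"] conj_F [of b r s] by (simp add: conj_conj)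

text \<open>Nonzero pairings occur only between types (2, 0) and (0, 2) and within type (1, 1), and
  there the eigenvalues of the two arguments add up to zero.\<close>

lemma D_skew: "QC (D x) y = - QC x (D y)"
proof -
  interpret bilinear_form sC QC by (rule QC_form)
  have minus: "QC (- u) v = - QC u v" "QC u (- v) = - QC u v" for u v
    using add_left [of u "- u" v] add_right [of u v "- v"] add_left [of 0 0 v] add_right [of u 0 0]
    by (simp_all add: eq_neg_iff_add_eq_0 add.commute)
  obtain a b c where x: "a \<in> F 2 0" "b \<in> F 1 1" "c \<in> F 0 2" "x = a + b + c"
    using sum_F by blast
  obtain a' b' c' where y: "a' \<in> F 2 0" "b' \<in> F 1 1" "c' \<in> F 0 2" "y = a' + b' + c'"
    using sum_F by blast
  have "QC a a' = 0" "QC a b' = 0" "QC b a' = 0" "QC b c' = 0" "QC c b' = 0" "QC c c' = 0"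
    using x y by (auto intro: QC_orthogonal)
  then have "QC (a + - c) (a' + b' + c') = - QC (a + b + c) (a' + - c')"
    by (simp add: add_left add_right minus del: add_uminus_conv_diff)
  then show ?thesis
    using D_eq [OF x(1-3)] D_eq [OF y(1-3)] by (simp add: x(4) y(4))
qed

lemma D_add: "D (x + y) = D x + D y"
proof -
  obtain a b c where x: "a \<in> F 2 0" "b \<in> F 1 1" "c \<in> F 0 2" "x = a + b + c"
    using sum_F by blast
  obtain a' b' c' where y: "a' \<in> F 2 0" "b' \<in> F 1 1" "c' \<in> F 0 2" "y = a' + b' + c'"
    using sum_F by blast
  have "D ((a + a') + (b + b') + (c + c')) = (a + a') - (c + c')"
    using x y by (intro D_eq F_closed)
  moreover have "(a + a') + (b + b') + (c + c') = x + y"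
    by (simp add: x(4) y(4))
  ultimately have "D (x + y) = (a + a') - (c + c')"
    by simp
  then show ?thesis
    using D_eq [OF x(1-3)] D_eq [OF y(1-3)] by (simp flip: x(4) y(4))
qed

lemma D_scale: "D (sC k x) = sC k (D x)"
proof -
  note C = module_ofD [OF module_C]
  have minus: "sC k (u - v) = sC k u - sC k v" for u v
    using C(2) [of k "u - v" v] by simp
  obtain a b c where x: "a \<in> F 2 0" "b \<in> F 1 1" "c \<in> F 0 2" "x = a + b + c"
    using sum_F by blast
  have "D (sC k a + sC k b + sC k c) = sC k a - sC k c"
    using x by (intro D_eq F_closed)
  then show ?thesis
    using D_eq [OF x(1-3)] by (simp add: x(4) C(2) minus)
qed

lemma D_conj: "D (cj x) = - cj (D x)"
proof -
  obtain a b c where x: "a \<in> F 2 0" "b \<in> F 1 1" "c \<in> F 0 2" "x = a + b + c"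
    using sum_F by blast
  have "D (cj c + cj b + cj a) = cj c - cj a"
    using x by (intro D_eq conj_F)
  moreover have "cj x = cj c + cj b + cj a"
    by (simp add: x(4) conj_add add_ac)
  moreover have "cj (a + - c) = cj a - cj c"
    by (simp only: conj_add conj_minus diff_conv_add_uminus)
  ultimately show ?thesis
    using D_eq [OF x(1-3)] by (simp add: x(4))
qed

lemma hodge_grading: "\<exists>\<sigma> \<tau>. hodge_grading sC QC F D \<sigma> \<tau>"
proof -
  obtain \<sigma> where \<sigma>: "F 2 0 \<subseteq> range (\<lambda>c. sC c \<sigma>)"
    using one_dimensional [OF module_C dim_20] by blast
  \<comment> \<open>The dimension hypothesis concerns type (2, 0); conjugation carries the line to
    type (0, 2), with spanning vector \<open>cj \<sigma>\<close>.\<close>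
  have "F 0 2 = cj ` F 2 0"
    by (simp add: cj_types)
  also have "\<dots> \<subseteq> cj ` range (\<lambda>c. sC c \<sigma>)"
    using \<sigma> by (rule image_mono)
  also have "\<dots> \<subseteq> range (\<lambda>c. sC c (cj \<sigma>))"
    by (auto simp: conj_scale)
  finally have \<tau>: "F 0 2 \<subseteq> range (\<lambda>c. sC c (cj \<sigma>))" .
  have "hodge_grading sC QC F D \<sigma> (cj \<sigma>)"
  proof (intro hodge_grading.intro QC_form, unfold_locales)
    show "D x = x" if "x \<in> F 2 0" for x
      using D_eq [OF that F_closed(1) F_closed(1)] by simp
    show "D x = 0" if "x \<in> F 1 1" for x
      using D_eq [OF F_closed(1) that F_closed(1)] by simp
    show "D x = - x" if "x \<in> F 0 2" for x
      using D_eq [OF F_closed(1) F_closed(1) that] by simp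
  qed (simp_all add: D_add D_scale D_skew sum_F \<sigma> \<tau>)
  then show ?thesis by blast
qed

section \<open>Lattice, conjugation and Hodge structure on the Clifford algebra\<close>

abbreviation "CH \<equiv> clifford_algebra sZ Q"
abbreviation "CHC \<equiv> clifford_algebra sC QC"
abbreviation "incl \<equiv> clifford_map sZ Q sC QC of_int \<iota>"
abbreviation "cjC \<equiv> clifford_map sC QC sC QC cnj cj"
abbreviation "FC \<equiv> clifford_hodge sC QC F"

sublocale int: ring_hom1 "of_int :: int \<Rightarrow> complex"
  by standard simp_all

sublocale conj: ring_hom1 cnj
  by standard simp_all

lemma incl_class: "incl (clifford_class sZ Q p) = clifford_class sC QC (free_map of_int \<iota> p)"
  by (rule int.clifford_map_class) (simp_all add: \<iota>_add \<iota>_scale QC_\<iota>)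

lemma cjC_class: "cjC (clifford_class sC QC p) = clifford_class sC QC (free_map cnj cj p)"
  by (rule conj.clifford_map_class) (simp_all add: conj_add conj_scale QC_conj)

text \<open>Ordering a lattice basis as a list \<open>bs\<close>, and its image as
  \<open>map \<iota> bs\<close>, makes \<open>incl\<close> send each integral basis monomial to the
  complex one with the same index.\<close>

lemma complexified_lattice_clifford: "complexified_lattice CH CHC incl"
proof -
  obtain A where A: "finite_basis (module_of sZ) A" "inj_on \<iota> A" "finite_basis (module_of sC) (\<iota> ` A)"
    by (rule basis)
  have "finite A" using A(1) by (simp add: finite_basis_def)
  then obtain bs where bs: "set bs = A" "distinct bs"
    using finite_distinct_list by blast
  let ?S = "set (subseqs bs)"
  let ?\<beta> = "\<lambda>w. clifford_class sZ Q (word w)" and ?\<beta>C = "\<lambda>w. clifford_class sC QC (word w)"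
  have basis_Z: "finite_basis CH (?\<beta> ` ?S)"
    using bilinear_form.clifford_basis(2) [OF Q_form module_Z] A(1) bs by simp
  have "finite_basis (module_of sC) (set (map \<iota> bs))" "distinct (map \<iota> bs)"
    using A bs by (simp_all add: distinct_map)
  note C = bilinear_form.clifford_basis [OF QC_form module_C this]
  have S: "set (subseqs (map \<iota> bs)) = map \<iota> ` ?S"
    by (simp add: subseqs_map)
  have incl: "incl (?\<beta> w) = ?\<beta>C (map \<iota> w)" for w
    by (simp add: incl_class)
  \<comment> \<open>Injectivity is obtained in two stages: from words over the lattice to words over
    the complex space, then from words to their classes.\<close>
  have "inj_on (map \<iota>) ?S"
  proof (rule inj_onI)
    fix u v assume uv: "u \<in> ?S" "v \<in> ?S" "map \<iota> u = map \<iota> v"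
    have "inj_on \<iota> (set u \<union> set v)"
      using set_subset_of_subseqs [OF uv(1)] set_subset_of_subseqs [OF uv(2)] A(2) bs(1)
      by (auto intro: inj_on_subset)
    then show "u = v" using uv(3) by (simp add: inj_on_map_eq_map)
  qed
  then have inj: "inj_on (\<lambda>w. ?\<beta>C (map \<iota> w)) ?S"
    using comp_inj_on [of "map \<iota>" ?S ?\<beta>C] C(1) by (simp add: S comp_def)
  have "inj_on incl (?\<beta> ` ?S)"
  proof (rule inj_onI)
    fix X Y assume "X \<in> ?\<beta> ` ?S" "Y \<in> ?\<beta> ` ?S" and eq: "incl X = incl Y"
    then obtain u v where "u \<in> ?S" "v \<in> ?S" "X = ?\<beta> u" "Y = ?\<beta> v" by blast
    moreover from this have "u = v"
      using eq by (intro inj_onD [OF inj]) (simp_all add: incl)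
    ultimately show "X = Y" by simp
  qed
  moreover have "finite_basis CHC (incl ` ?\<beta> ` ?S)"
    using C(2) by (simp add: S image_image incl)
  moreover have "incl \<in> carrier CH \<rightarrow> carrier CHC"
    by (auto simp: clifford_algebra incl_class)
  moreover have "incl (X \<oplus>\<^bsub>CH\<^esub> Y) = incl X \<oplus>\<^bsub>CHC\<^esub> incl Y"
    if "X \<in> carrier CH" "Y \<in> carrier CH" for X Y
    using that by (elim clifford_class_cases) (simp add: clifford_algebra incl_class)
  ultimately show ?thesis
    unfolding complexified_lattice_def using basis_Z by (auto simp: module_clifford_algebra)
qed

lemma cjC_F: "X \<in> FC p q \<Longrightarrow> cjC X \<in> FC q p"
proof -
  obtain \<sigma> \<tau> where "hodge_grading sC QC F D \<sigma> \<tau>" using hodge_grading by blast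
  then interpret hodge_grading sC QC F D \<sigma> \<tau> .
  assume X: "X \<in> FC p q"
  then obtain x where "X = clifford_class sC QC x"
    using clifford_hodge_subset by blast
  then show ?thesis
    using clifford_hodge_conjugate [of cj x p q] X
    by (simp add: cjC_class conj_add conj_scale QC_conj D_conj)
qed

lemma cjC_cjC: "X \<in> carrier CHC \<Longrightarrow> cjC (cjC X) = X"
proof (elim clifford_class_cases)
  fix p assume "X = clifford_class sC QC p"
  moreover have "free_map cnj cj (free_map cnj cj p) = p"
    by (induction p rule: free_algebra_induct) (simp_all add: conj_conj)
  ultimately show "cjC (cjC X) = X" by (simp add: cjC_class)
qed

lemma clifford_hodge_structure: "hodge_structure2 CH CHC incl cjC FC"
proof -
  obtain \<sigma> \<tau> where "hodge_grading sC QC F D \<sigma> \<tau>" using hodge_grading by blast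
  then interpret hodge_grading sC QC F D \<sigma> \<tau> .
  show ?thesis
  proof (rule hodge_structure2.intro)
    show "complexified_lattice CH CHC incl" by (rule complexified_lattice_clifford)
    show "cjC \<in> carrier CHC \<rightarrow> carrier CHC"
      by (auto simp: clifford_algebra cjC_class)
    show "cjC (x \<oplus>\<^bsub>CHC\<^esub> y) = cjC x \<oplus>\<^bsub>CHC\<^esub> cjC y" if "x \<in> carrier CHC" "y \<in> carrier CHC" for x y
      using that by (elim clifford_class_cases) (simp add: clifford_algebra cjC_class)
    show "cjC (c \<odot>\<^bsub>CHC\<^esub> x) = cnj c \<odot>\<^bsub>CHC\<^esub> cjC x" if "x \<in> carrier CHC" for c x
      using that by (elim clifford_class_cases) (simp add: clifford_algebra cjC_class)
    show "cjC (incl x) = incl x" if "x \<in> carrier CH" for x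
      using that
    proof (elim clifford_class_cases)
      fix p assume "x = clifford_class sZ Q p"
      moreover have "free_map cnj cj (free_map of_int \<iota> p) = free_map of_int \<iota> p"
        by (induction p rule: free_algebra_induct) (simp_all add: conj_\<iota>)
      ultimately show "cjC (incl x) = incl x" by (simp add: incl_class cjC_class)
    qed
    show "submodule (FC p q) scalar_ring CHC" for p q
      by (rule submodule_clifford_hodge)
    show "FC p q = {\<zero>\<^bsub>CHC\<^esub>}" if "(p, q) \<notin> {(2, 0), (1, 1), (0, 2)}" for p q
      using clifford_hodge_other [OF that] by (simp add: clifford_algebra)
    show "\<exists>!(a, b, c). a \<in> FC 2 0 \<and> b \<in> FC 1 1 \<and> c \<in> FC 0 2 \<and> x = a \<oplus>\<^bsub>CHC\<^esub> b \<oplus>\<^bsub>CHC\<^esub> c"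
      if "x \<in> carrier CHC" for x
      using that by (rule clifford_hodge_decomposition)
    show "cjC ` FC p q = FC q p" for p q
    proof
      show "cjC ` FC p q \<subseteq> FC q p" using cjC_F by blast
      \<comment> \<open>The reverse inclusion follows from the first one because \<open>cjC\<close>
        is an involution.\<close>
      show "FC q p \<subseteq> cjC ` FC p q"
      proof
        fix X assume X: "X \<in> FC q p"
        then have "X \<in> carrier CHC" by (simp add: clifford_hodge_def)
        then have "X = cjC (cjC X)" by (simp add: cjC_cjC)
        then show "X \<in> cjC ` FC p q" using cjC_F [OF X] by (rule image_eqI)
      qed
    qed
  qed
qed

lemma clifford_hodge_product: "hodge_product CH CHC incl FC (- 1) (- 1) (mult CH) (mult CHC)"
proof -
  obtain \<sigma> \<tau> where "hodge_grading sC QC F D \<sigma> \<tau>" using hodge_grading by blast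
  then interpret hodge_grading sC QC F D \<sigma> \<tau> .
  have "incl (X \<otimes>\<^bsub>CH\<^esub> Y) = incl X \<otimes>\<^bsub>CHC\<^esub> incl Y" if "X \<in> carrier CH" "Y \<in> carrier CH" for X Y
    using that by (elim clifford_class_cases) (simp add: clifford_algebra incl_class)
  then show ?thesis
    unfolding hodge_product_def using clifford_hodge_mult
    by (simp add: bilinear_map_clifford_mult)
qed

end

theorem lemma2:
  fixes sZ :: "int \<Rightarrow> 'h \<Rightarrow> 'h::ab_group_add" and sC :: "complex \<Rightarrow> 'v \<Rightarrow> 'v::ab_group_add"
    and \<iota> :: "'h \<Rightarrow> 'v" and cj :: "'v \<Rightarrow> 'v" and F :: "int \<Rightarrow> int \<Rightarrow> 'v set"
    and Q :: "'h \<Rightarrow> 'h \<Rightarrow> int" and QC :: "'v \<Rightarrow> 'v \<Rightarrow> complex"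
  assumes "polarized_hodge_structure2 (module_of sZ) (module_of sC) \<iota> cj F Q QC"
    and "vector_space.dim sC (F 2 0) = 1"
  defines "CH \<equiv> clifford_algebra sZ Q" and "CHC \<equiv> clifford_algebra sC QC"
    and "incl \<equiv> clifford_map sZ Q sC QC of_int \<iota>"
    and "cjC \<equiv> clifford_map sC QC sC QC cnj cj"
    and "FC \<equiv> clifford_hodge sC QC F"
  shows "hodge_structure2 CH CHC incl cjC FC \<and>
    hodge_product CH CHC incl FC (- 1) (- 1) (mult CH) (mult CHC)"
proof -
  interpret polarized_structure sZ sC \<iota> cj F Q QC
    by (intro polarized_structure.intro polarized_structure_axioms.intro assms)
  show ?thesis
    unfolding CH_def CHC_def incl_def cjC_def FC_def
    by (intro conjI clifford_hodge_structure clifford_hodge_product)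
qed

end
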